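(* Let $K$ be a field of characteristic $0$, and let $\mathcal{A}s_1\langle X\rangle$ be the free first-type associative algebra over $K$ generated by the set $X$. Let $\mathcal{A}s_1^{(+)}\langle X\rangle$ be the same vector space with the anti-commutator operation $\{a,b\}=ab+ba$. Then all identities of the algebra $\mathcal{A}s_1^{(+)}\langle X\rangle$ up to degree $4$ follow from commutativity $\{a,b\}=\{b,a\}$ and the following identities (which hold in $\mathcal{A}s_1^{(+)}\langle X\rangle$): $$\{a,\{b,c\}\}+\{b,\{c,a\}\}+\{c,\{a,b\}\}=0$$ and $$\{\{\{a,b\},c\},d\}+\{\{\{a,b\},d\},c\}+\{\{\{a,c\}, b\},d\}+\{\{\{a,c\},d\},b\}+\{\{\{a,d\},b\},c\}+\{\{\{a,d\},c\},b\}=0.$$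
   Context: A first-type associative algebra is an associative (not necessarily unital) $K$-algebra satisfying the identity $abc+bac+acb+cab+bca+cba=0$; $\mathcal{A}s_1$ is the variety of all such algebras and $\mathcal{A}s_1\langle X\rangle$ is the free algebra of this variety generated by the set $X$. An identity of an algebra with one bilinear operation $\{\cdot,\cdot\}$ is an element $f$ of the free nonassociative (magmatic) algebra in that operation that vanishes under every substitution of elements of the algebra for the variables. An identity follows from given identities if it lies in the ideal of the free nonassociative algebra, closed under all substitutions (T-ideal), generated by them.
   Formalization: The claim that all identities up to degree 4 follow is stated for X with at least two elements; it fails for empty X (the algebra is 0) and for one generator, where x^3=0 makes {{a,b},c}=0 an identity that does not follow from the listed ones. *)

theory Defs
  imports Complex_Main "HOL-Library.Poly_Mapping"
begin

section \<open>The free nonassociative (magmatic) algebra\<close>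

datatype 'v magma = MVar 'v | MOp "'v magma" "'v magma"

primrec monomial_length :: "'v magma \<Rightarrow> nat" where
  "monomial_length (MVar v) = 1"
| "monomial_length (MOp s t) = monomial_length s + monomial_length t"

type_synonym ('v, 'k) nonassoc = "'v magma \<Rightarrow>\<^sub>0 'k"

definition nvar :: "'v \<Rightarrow> ('v, 'k::field) nonassoc" where
  "nvar v = Poly_Mapping.single (MVar v) 1"

definition nscale :: "'k::field \<Rightarrow> ('v, 'k) nonassoc \<Rightarrow> ('v, 'k) nonassoc" where
  "nscale c f = Poly_Mapping.map ((*) c) f"

definition nprod :: "('v, 'k::field) nonassoc \<Rightarrow> ('v, 'k) nonassoc \<Rightarrow> ('v, 'k) nonassoc"
    (infixl \<open>\<odot>\<close> 70) where
  "f \<odot> g = (\<Sum>s\<in>Poly_Mapping.keys f. \<Sum>t\<in>Poly_Mapping.keys g.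
     Poly_Mapping.single (MOp s t) (Poly_Mapping.lookup f s * Poly_Mapping.lookup g t))"

definition total_degree :: "('v, 'k::field) nonassoc \<Rightarrow> nat" where
  "total_degree f = Max (insert 0 (monomial_length ` Poly_Mapping.keys f))"

section \<open>Evaluation, identities, ideals and T-ideals\<close>

primrec eval_monomial :: "('a \<Rightarrow> 'a \<Rightarrow> 'a) \<Rightarrow> ('v \<Rightarrow> 'a) \<Rightarrow> 'v magma \<Rightarrow> 'a" where
  "eval_monomial opr \<sigma> (MVar v) = \<sigma> v"
| "eval_monomial opr \<sigma> (MOp s t) = opr (eval_monomial opr \<sigma> s) (eval_monomial opr \<sigma> t)"

text \<open>A nonassociative algebra is given by its scalar multiplication and its operation
  \<open>opr\<close>; its additive structure comes from the type.\<close>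

definition evaluate ::
    "('k::field \<Rightarrow> 'a::ab_group_add \<Rightarrow> 'a) \<Rightarrow> ('a \<Rightarrow> 'a \<Rightarrow> 'a) \<Rightarrow> ('v \<Rightarrow> 'a) \<Rightarrow> ('v, 'k) nonassoc \<Rightarrow> 'a"
  where "evaluate scale opr \<sigma> f = (\<Sum>m\<in>Poly_Mapping.keys f. scale (Poly_Mapping.lookup f m) (eval_monomial opr \<sigma> m))"

definition is_identity ::
    "('k::field \<Rightarrow> 'a::ab_group_add \<Rightarrow> 'a) \<Rightarrow> ('a \<Rightarrow> 'a \<Rightarrow> 'a) \<Rightarrow> (nat, 'k) nonassoc \<Rightarrow> bool"
  where "is_identity scale opr f \<longleftrightarrow> (\<forall>\<sigma>. evaluate scale opr \<sigma> f = 0)"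

definition nsubst ::
    "('v \<Rightarrow> ('w, 'k::field) nonassoc) \<Rightarrow> ('v, 'k) nonassoc \<Rightarrow> ('w, 'k) nonassoc" where
  "nsubst = evaluate nscale nprod"

definition nideal :: "('v, 'k::field) nonassoc set \<Rightarrow> bool" where
  "nideal J \<longleftrightarrow> 0 \<in> J \<and> (\<forall>f\<in>J. \<forall>g\<in>J. f + g \<in> J) \<and> (\<forall>c. \<forall>f\<in>J. nscale c f \<in> J) \<and>
     (\<forall>f\<in>J. \<forall>g. f \<odot> g \<in> J \<and> g \<odot> f \<in> J)"

definition T_ideal :: "('v, 'k::field) nonassoc set \<Rightarrow> bool" where
  "T_ideal J \<longleftrightarrow> nideal J \<and> (\<forall>\<sigma>. \<forall>f\<in>J. nsubst \<sigma> f \<in> J)"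

definition follows_from :: "(nat, 'k::field) nonassoc \<Rightarrow> (nat, 'k) nonassoc set \<Rightarrow> bool" where
  "follows_from f S \<longleftrightarrow> f \<in> T_ideal hull S"

lemma nideal_hull: "nideal (nideal hull S)"
  by (rule hull_in) (auto simp: nideal_def)

lemma T_ideal_hull: "T_ideal (T_ideal hull S)"
  by (rule hull_in) (auto simp: T_ideal_def nideal_def)

lemma lookup_nscale [simp]: "Poly_Mapping.lookup (nscale c f) m = c * Poly_Mapping.lookup f m"
  by (simp add: nscale_def Poly_Mapping.map.rep_eq when_def)

lemma nprod_superset:
  assumes "finite A" "finite B" "Poly_Mapping.keys f \<subseteq> A" "Poly_Mapping.keys g \<subseteq> B"
  shows "f \<odot> g = (\<Sum>s\<in>A. \<Sum>t\<in>B. Poly_Mapping.single (MOp s t) (Poly_Mapping.lookup f s * Poly_Mapping.lookup g t))"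
proof -
  have "f \<odot> g = (\<Sum>s\<in>Poly_Mapping.keys f. \<Sum>t\<in>B. Poly_Mapping.single (MOp s t) (Poly_Mapping.lookup f s * Poly_Mapping.lookup g t))"
    unfolding nprod_def using assms
    by (intro sum.cong refl sum.mono_neutral_left) (auto simp: in_keys_iff)
  also have "\<dots> = (\<Sum>s\<in>A. \<Sum>t\<in>B. Poly_Mapping.single (MOp s t) (Poly_Mapping.lookup f s * Poly_Mapping.lookup g t))"
    using assms by (intro sum.mono_neutral_left) (auto simp: in_keys_iff)
  finally show ?thesis .
qed

lemma nprod_add_left: "(f + g) \<odot> h = f \<odot> h + g \<odot> h"
proof -
  let ?A = "Poly_Mapping.keys f \<union> Poly_Mapping.keys g"
  have "Poly_Mapping.keys (f + g) \<subseteq> ?A" by (rule Poly_Mapping.keys_add)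
  then show ?thesis
    by (simp add: nprod_superset[of ?A "Poly_Mapping.keys h"] lookup_add distrib_right
        single_add sum.distrib)
qed

lemma nprod_add_right: "h \<odot> (f + g) = h \<odot> f + h \<odot> g"
proof -
  let ?A = "Poly_Mapping.keys f \<union> Poly_Mapping.keys g"
  have "Poly_Mapping.keys (f + g) \<subseteq> ?A" by (rule Poly_Mapping.keys_add)
  then show ?thesis
    by (simp add: nprod_superset[of "Poly_Mapping.keys h" ?A] lookup_add distrib_left
        single_add sum.distrib)
qed

lemma nscale_single: "nscale c (Poly_Mapping.single m a) = Poly_Mapping.single m (c * a)"
  by (rule poly_mapping_eqI) (simp add: lookup_single when_def)

lemma nscale_add: "nscale c (f + g) = nscale c f + nscale c g"
  by (rule poly_mapping_eqI) (simp add: lookup_add distrib_left)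

lemma nscale_add_left: "nscale (c + d) f = nscale c f + nscale d f"
  by (rule poly_mapping_eqI) (simp add: lookup_add distrib_right)

lemma nscale_nscale: "nscale c (nscale d f) = nscale (c * d) f"
  by (rule poly_mapping_eqI) (simp add: mult.assoc)

lemma nscale_one [simp]: "nscale 1 f = f"
  by (rule poly_mapping_eqI) simp

lemma nscale_zero [simp]: "nscale c 0 = 0"
  by (rule poly_mapping_eqI) simp

lemma nscale_sum: "nscale c (\<Sum>i\<in>A. f i) = (\<Sum>i\<in>A. nscale c (f i))"
  by (induction A rule: infinite_finite_induct) (auto simp: nscale_add)

lemma keys_nscale: "Poly_Mapping.keys (nscale c f) \<subseteq> Poly_Mapping.keys f"
  by (auto simp: in_keys_iff)

lemma nprod_nscale_left: "nscale c f \<odot> g = nscale c (f \<odot> g)"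
  unfolding nprod_superset[OF finite_keys finite_keys keys_nscale order_refl, of c f g]
  by (simp add: nprod_def nscale_sum nscale_single mult.assoc)

lemma nprod_nscale_right: "f \<odot> nscale c g = nscale c (f \<odot> g)"
  unfolding nprod_superset[OF finite_keys finite_keys order_refl keys_nscale, of f c g]
  by (simp add: nprod_def nscale_sum nscale_single mult.left_commute)

lemma nscale_vector_space: "vector_space nscale"
  by standard (simp_all add: nscale_add nscale_add_left nscale_nscale)

lemma uminus_eq_nscale: "- f = nscale (- 1) f"
  by (rule poly_mapping_eqI) simp

lemma nprod_diff_left: "(f - g) \<odot> h = f \<odot> h - g \<odot> h"
  by (metis add_diff_cancel diff_add_cancel nprod_add_left)

lemma nprod_diff_right: "h \<odot> (f - g) = h \<odot> f - h \<odot> g"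
  by (metis add_diff_cancel diff_add_cancel nprod_add_right)

lemma nideal_uminus: "nideal J \<Longrightarrow> f \<in> J \<Longrightarrow> - f \<in> J"
  by (simp add: nideal_def uminus_eq_nscale)

lemma nideal_diff: "nideal J \<Longrightarrow> f \<in> J \<Longrightarrow> g \<in> J \<Longrightarrow> f - g \<in> J"
  using nideal_uminus[of J g] unfolding nideal_def by (metis diff_conv_add_uminus)

section \<open>The free first-type associative algebra\<close>

text \<open>The free algebra of the variety of associative algebras satisfying
  \<open>abc + bac + acb + cab + bca + cba = 0\<close>, generated by the elements of the type \<open>'x\<close>: the
  quotient of the free nonassociative algebra by the ideal generated by all values of the
  associator and of the left-hand side of this identity.\<close>

definition As1_relators :: "('x, 'k::field) nonassoc set" where
  "As1_relators =
     {(a \<odot> b) \<odot> c - a \<odot> (b \<odot> c) | a b c. True} \<union>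
     {(a \<odot> b) \<odot> c + (b \<odot> a) \<odot> c + (a \<odot> c) \<odot> b + (c \<odot> a) \<odot> b + (b \<odot> c) \<odot> a + (c \<odot> b) \<odot> a
       | a b c. True}"

definition As1_ideal :: "('x, 'k::field) nonassoc set" where
  "As1_ideal = nideal hull As1_relators"

definition As1_rel :: "('x, 'k::field) nonassoc \<Rightarrow> ('x, 'k) nonassoc \<Rightarrow> bool" where
  "As1_rel f g \<longleftrightarrow> f - g \<in> As1_ideal"

lemma As1_ideal: "nideal As1_ideal"
  unfolding As1_ideal_def by (rule nideal_hull)

lemma As1_ideal_intros:
  "0 \<in> As1_ideal"
  "f \<in> As1_ideal \<Longrightarrow> g \<in> As1_ideal \<Longrightarrow> f + g \<in> As1_ideal"
  "f \<in> As1_ideal \<Longrightarrow> g \<in> As1_ideal \<Longrightarrow> f - g \<in> As1_ideal"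
  "f \<in> As1_ideal \<Longrightarrow> - f \<in> As1_ideal"
  "f \<in> As1_ideal \<Longrightarrow> nscale c f \<in> As1_ideal"
  "f \<in> As1_ideal \<Longrightarrow> f \<odot> g \<in> As1_ideal"
  "f \<in> As1_ideal \<Longrightarrow> g \<odot> f \<in> As1_ideal"
  using As1_ideal nideal_diff[OF As1_ideal] nideal_uminus[OF As1_ideal]
  by (auto simp: nideal_def)

lemma As1_rel_refl: "As1_rel f f"
  by (simp add: As1_rel_def As1_ideal_intros)

lemma As1_rel_equivp: "equivp As1_rel"
proof (rule equivpI)
  show "reflp As1_rel" by (simp add: reflp_def As1_rel_refl)
  show "symp As1_rel"
    unfolding symp_def As1_rel_def by (metis As1_ideal_intros(4) minus_diff_eq)
  show "transp As1_rel"
    unfolding transp_def As1_rel_def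
  proof (intro allI impI)
    fix f g h
    assume "f - g \<in> As1_ideal" "g - h \<in> As1_ideal"
    then have "(f - g) + (g - h) \<in> As1_ideal" by (rule As1_ideal_intros(2))
    then show "f - h \<in> As1_ideal" by simp
  qed
qed

quotient_type (overloaded) ('x, 'k) As1 = "('x, 'k::field) nonassoc" / As1_rel
  by (rule As1_rel_equivp)

instantiation As1 :: (type, field) ring
begin

lift_definition zero_As1 :: "('a, 'b) As1" is 0 .

lift_definition plus_As1 :: "('a, 'b) As1 \<Rightarrow> ('a, 'b) As1 \<Rightarrow> ('a, 'b) As1" is "(+)"
  unfolding As1_rel_def by (metis As1_ideal_intros(2) add_diff_add)

lift_definition minus_As1 :: "('a, 'b) As1 \<Rightarrow> ('a, 'b) As1 \<Rightarrow> ('a, 'b) As1" is "(-)"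
proof -
  fix f f' g g' :: "('a, 'b) nonassoc"
  assume "As1_rel f f'" "As1_rel g g'"
  then have "(f - f') - (g - g') \<in> As1_ideal"
    by (simp only: As1_rel_def As1_ideal_intros)
  then show "As1_rel (f - g) (f' - g')"
    by (simp add: As1_rel_def algebra_simps)
qed

lift_definition uminus_As1 :: "('a, 'b) As1 \<Rightarrow> ('a, 'b) As1" is uminus
  unfolding As1_rel_def by (metis As1_ideal_intros(4) minus_diff_minus)

lift_definition times_As1 :: "('a, 'b) As1 \<Rightarrow> ('a, 'b) As1 \<Rightarrow> ('a, 'b) As1" is nprod
proof -
  fix f f' g g' :: "('a, 'b) nonassoc"
  assume "As1_rel f f'" "As1_rel g g'"
  then have "(f - f') \<odot> g + f' \<odot> (g - g') \<in> As1_ideal"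
    by (simp add: As1_rel_def As1_ideal_intros)
  then show "As1_rel (f \<odot> g) (f' \<odot> g')"
    by (simp add: As1_rel_def nprod_diff_left nprod_diff_right)
qed

instance
proof
  fix a b c :: "('a, 'b) As1"
  show "a * b * c = a * (b * c)"
  proof transfer
    fix f g h :: "('a, 'b) nonassoc"
    show "As1_rel (f \<odot> g \<odot> h) (f \<odot> (g \<odot> h))"
      unfolding As1_rel_def As1_ideal_def by (rule hull_inc) (auto simp: As1_relators_def)
  qed
qed (transfer; simp add: As1_rel_refl nprod_add_left nprod_add_right algebra_simps)+

end

lift_definition As1_scale :: "'k::field \<Rightarrow> ('x, 'k) As1 \<Rightarrow> ('x, 'k) As1" is nscale
proof -
  fix c :: 'k and f g :: "('x, 'k) nonassoc"
  assume "As1_rel f g"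
  then have "nscale c (f - g) \<in> As1_ideal" by (simp add: As1_rel_def As1_ideal_intros)
  moreover have "nscale c (f - g) = nscale c f - nscale c g"
    by (rule poly_mapping_eqI) (simp add: lookup_minus right_diff_distrib)
  ultimately show "As1_rel (nscale c f) (nscale c g)" by (simp add: As1_rel_def)
qed

lift_definition As1_gen :: "'x \<Rightarrow> ('x, 'k::field) As1" is nvar .

definition anticommutator :: "'a::ring \<Rightarrow> 'a \<Rightarrow> 'a" where
  "anticommutator a b = a * b + b * a"

section \<open>The identities\<close>

definition commutativity :: "(nat, 'k::field) nonassoc" where
  "commutativity = (let a = nvar 0; b = nvar 1 in a \<odot> b - b \<odot> a)"

definition jacobi_identity :: "(nat, 'k::field) nonassoc" where
  "jacobi_identity = (let a = nvar 0; b = nvar 1; c = nvar 2 in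
     a \<odot> (b \<odot> c) + b \<odot> (c \<odot> a) + c \<odot> (a \<odot> b))"

definition quartic_identity :: "(nat, 'k::field) nonassoc" where
  "quartic_identity = (let a = nvar 0; b = nvar 1; c = nvar 2; d = nvar 3 in
     ((a \<odot> b) \<odot> c) \<odot> d + ((a \<odot> b) \<odot> d) \<odot> c + ((a \<odot> c) \<odot> b) \<odot> d +
     ((a \<odot> c) \<odot> d) \<odot> b + ((a \<odot> d) \<odot> b) \<odot> c + ((a \<odot> d) \<odot> c) \<odot> b)"

section \<open>The algebra \<open>As1\<close> is the free algebra of its variety\<close>

lemma As1_scale_vector_space:
  "vector_space (As1_scale :: 'k::field \<Rightarrow> ('x, 'k) As1 \<Rightarrow> ('x, 'k) As1)"
proof
  fix r q :: 'k and a b :: "('x, 'k) As1"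
  show "As1_scale r (a + b) = As1_scale r a + As1_scale r b"
    by transfer (simp add: nscale_add As1_rel_refl)
  show "As1_scale (r + q) a = As1_scale r a + As1_scale q a"
    by transfer (simp add: nscale_add_left As1_rel_refl)
  show "As1_scale r (As1_scale q a) = As1_scale (r * q) a"
    by transfer (simp add: nscale_nscale As1_rel_refl)
  show "As1_scale 1 a = a"
    by transfer (simp add: nscale_one As1_rel_refl)
qed

lemma As1_scale_mult:
  "As1_scale c a * b = As1_scale c (a * b)" "a * As1_scale c b = As1_scale c (a * b)"
  by (transfer; simp add: nprod_nscale_left nprod_nscale_right As1_rel_refl)+

lemma As1_first_type:
  fixes a b c :: "('x, 'k::field) As1"
  shows "a * b * c + b * a * c + a * c * b + c * a * b + b * c * a + c * b * a = 0"
proof transfer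
  fix a b c :: "('x, 'k) nonassoc"
  show "As1_rel ((a \<odot> b) \<odot> c + (b \<odot> a) \<odot> c + (a \<odot> c) \<odot> b + (c \<odot> a) \<odot> b + (b \<odot> c) \<odot> a + (c \<odot> b) \<odot> a) 0"
    unfolding As1_rel_def As1_ideal_def diff_zero
    by (rule hull_inc) (unfold As1_relators_def, blast)
qed

locale nonassoc_algebra = vector_space scale
  for scale :: "'k::field \<Rightarrow> 'a::ab_group_add \<Rightarrow> 'a" +
  fixes opr :: "'a \<Rightarrow> 'a \<Rightarrow> 'a"
  assumes opr_add_left: "opr (a + b) c = opr a c + opr b c"
    and opr_add_right: "opr c (a + b) = opr c a + opr c b"
    and opr_scale_left: "opr (scale r a) b = scale r (opr a b)"
    and opr_scale_right: "opr a (scale r b) = scale r (opr a b)"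
begin

lemma evaluate_superset:
  assumes "finite A" "Poly_Mapping.keys f \<subseteq> A"
  shows "evaluate scale opr \<sigma> f = (\<Sum>m\<in>A. scale (Poly_Mapping.lookup f m) (eval_monomial opr \<sigma> m))"
  unfolding evaluate_def using assms by (intro sum.mono_neutral_left) (auto simp: in_keys_iff)

lemma evaluate_add: "evaluate scale opr \<sigma> (f + g) = evaluate scale opr \<sigma> f + evaluate scale opr \<sigma> g"
proof -
  have "Poly_Mapping.keys (f + g) \<subseteq> Poly_Mapping.keys f \<union> Poly_Mapping.keys g" by (rule Poly_Mapping.keys_add)
  then show ?thesis
    by (simp add: evaluate_superset[of "Poly_Mapping.keys f \<union> Poly_Mapping.keys g"] lookup_add scale_left_distrib sum.distrib)
qed

lemma evaluate_nscale: "evaluate scale opr \<sigma> (nscale c f) = scale c (evaluate scale opr \<sigma> f)"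
  unfolding evaluate_superset[OF finite_keys keys_nscale, of \<sigma> c f]
  by (simp add: evaluate_def scale_sum_right)

lemma evaluate_zero [simp]: "evaluate scale opr \<sigma> 0 = 0"
  by (simp add: evaluate_def)

lemma evaluate_single: "evaluate scale opr \<sigma> (Poly_Mapping.single m c) = scale c (eval_monomial opr \<sigma> m)"
  by (simp add: evaluate_superset[of "{m}"] )

lemma evaluate_nvar [simp]: "evaluate scale opr \<sigma> (nvar v) = \<sigma> v"
  by (simp add: nvar_def evaluate_single)

lemma evaluate_sum: "evaluate scale opr \<sigma> (\<Sum>i\<in>A. f i) = (\<Sum>i\<in>A. evaluate scale opr \<sigma> (f i))"
  by (induction A rule: infinite_finite_induct) (auto simp: evaluate_add)

lemma evaluate_diff: "evaluate scale opr \<sigma> (f - g) = evaluate scale opr \<sigma> f - evaluate scale opr \<sigma> g"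
  by (metis add_diff_cancel diff_add_cancel evaluate_add)

lemma evaluate_nprod:
  "evaluate scale opr \<sigma> (f \<odot> g) = opr (evaluate scale opr \<sigma> f) (evaluate scale opr \<sigma> g)"
proof -
  have z: "opr 0 a = 0" "opr a 0 = 0" for a
    using opr_add_left[of 0 0 a] opr_add_right[of a 0 0] by auto
  have l: "opr (\<Sum>i\<in>A. F i) b = (\<Sum>i\<in>A. opr (F i) b)" for A :: "'v magma set" and F b
    by (induction A rule: infinite_finite_induct) (auto simp: z opr_add_left)
  have r: "opr b (\<Sum>i\<in>A. F i) = (\<Sum>i\<in>A. opr b (F i))" for A :: "'v magma set" and F b
    by (induction A rule: infinite_finite_induct) (auto simp: z opr_add_right)
  have "evaluate scale opr \<sigma> (f \<odot> g) = (\<Sum>s\<in>Poly_Mapping.keys f. \<Sum>t\<in>Poly_Mapping.keys g.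
      scale (Poly_Mapping.lookup f s * Poly_Mapping.lookup g t)
        (opr (eval_monomial opr \<sigma> s) (eval_monomial opr \<sigma> t)))"
    by (simp add: nprod_def evaluate_sum evaluate_single)
  also have "\<dots> = (\<Sum>s\<in>Poly_Mapping.keys f. \<Sum>t\<in>Poly_Mapping.keys g.
      opr (scale (Poly_Mapping.lookup f s) (eval_monomial opr \<sigma> s))
        (scale (Poly_Mapping.lookup g t) (eval_monomial opr \<sigma> t)))"
    by (simp add: opr_scale_left opr_scale_right mult.commute)
  also have "\<dots> = opr (evaluate scale opr \<sigma> f) (evaluate scale opr \<sigma> g)"
    unfolding evaluate_def l by (simp only: r)
  finally show ?thesis .
qed

end

lemma As1_induct [case_names gen add scale mult]:
  fixes P :: "('x, 'k::field) As1 \<Rightarrow> bool"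
  assumes gen: "\<And>x. P (As1_gen x)" and add: "\<And>a b. P a \<Longrightarrow> P b \<Longrightarrow> P (a + b)"
    and scale: "\<And>c a. P a \<Longrightarrow> P (As1_scale c a)" and mult: "\<And>a b. P a \<Longrightarrow> P b \<Longrightarrow> P (a * b)"
    and zero: "P 0"
  shows "P a"
proof -
  have mono: "P (abs_As1 (Poly_Mapping.single m 1))" for m
  proof (induction m)
    case (MVar v)
    show ?case using gen[of v] by (simp add: As1_gen.abs_eq nvar_def)
  next
    case (MOp s t)
    have "(Poly_Mapping.single s 1 :: ('x, 'k) nonassoc) \<odot> Poly_Mapping.single t 1
        = Poly_Mapping.single (MOp s t) 1"
      by (simp add: nprod_def)
    then show ?case using mult[OF MOp] by (simp add: times_As1.abs_eq)
  qed
  have "P (abs_As1 f)" for f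
  proof (induction f rule: update_induct)
    case const
    show ?case using zero by (simp add: zero_As1_def)
  next
    case (update f m c)
    have "Poly_Mapping.update m c f = f + nscale c (Poly_Mapping.single m 1)"
      using update(1)
      by (intro poly_mapping_eqI)
         (auto simp: lookup_update lookup_add lookup_single when_def in_keys_iff)
    then show ?case
      using add[OF update(3) scale[OF mono[of m], of c]]
      by (simp add: plus_As1.abs_eq As1_scale.abs_eq)
  qed
  then show ?thesis by (metis Quotient_As1 Quotient_abs_rep)
qed

theorem As1_universal:
  fixes scale :: "'k::field \<Rightarrow> 'a::ring \<Rightarrow> 'a" and g :: "'x \<Rightarrow> 'a"
  assumes vs: "vector_space scale"
    and sc: "\<And>r a b. scale r a * b = scale r (a * b)" "\<And>r a b. a * scale r b = scale r (a * b)"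
    and first: "\<And>a b c::'a. a * b * c + b * a * c + a * c * b + c * a * b + b * c * a + c * b * a = 0"
  shows "\<exists>!h :: ('x, 'k) As1 \<Rightarrow> 'a. Vector_Spaces.linear As1_scale scale h \<and>
           (\<forall>a b. h (a * b) = h a * h b) \<and> (\<forall>x. h (As1_gen x) = g x)"
proof -
  let ?e = "evaluate scale (*) g"
  interpret nonassoc_algebra scale "(*)"
    by (intro nonassoc_algebra.intro nonassoc_algebra_axioms.intro vs distrib_left distrib_right sc)
  note ev = evaluate_add evaluate_nscale evaluate_nprod evaluate_diff
  have "As1_ideal \<subseteq> {f. ?e f = 0}"
    unfolding As1_ideal_def
  proof (rule hull_minimal)
    show "As1_relators \<subseteq> {f. ?e f = 0}"
      by (auto simp: As1_relators_def ev mult.assoc first[unfolded mult.assoc])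
    show "nideal {f. ?e f = 0}" by (simp add: nideal_def ev)
  qed
  then have rel: "?e f = ?e f'" if "As1_rel f f'" for f f'
    using that by (auto simp: As1_rel_def ev)
  define h where "h a = ?e (rep_As1 a)" for a
  have h: "h (abs_As1 f) = ?e f" for f
    unfolding h_def by (rule rel) (metis Quotient_As1 Quotient_rep_abs As1_rel_refl)
  have ex: "\<exists>f. a = abs_As1 f" for a :: "('x, 'k) As1"
    by (metis Quotient_As1 Quotient_abs_rep)
  let ?P = "\<lambda>h :: ('x, 'k) As1 \<Rightarrow> 'a. Vector_Spaces.linear As1_scale scale h \<and>
           (\<forall>a b. h (a * b) = h a * h b) \<and> (\<forall>x. h (As1_gen x) = g x)"
  have lin: "Vector_Spaces.linear As1_scale scale h"
  proof (intro Vector_Spaces.linear_iff[THEN iffD2] conjI allI)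
    show "vector_space (As1_scale :: 'k \<Rightarrow> ('x, 'k) As1 \<Rightarrow> _)" by (rule As1_scale_vector_space)
    show "vector_space scale" by (rule vs)
    show "h (a + b) = h a + h b" for a b
      using ex[of a] ex[of b] by (auto simp: plus_As1.abs_eq h ev)
    show "h (As1_scale c a) = scale c (h a)" for c a
      using ex[of a] by (auto simp: As1_scale.abs_eq h ev)
  qed
  have mult: "h (a * b) = h a * h b" for a b
    using ex[of a] ex[of b] by (auto simp: times_As1.abs_eq h ev)
  have gen: "h (As1_gen x) = g x" for x
    by (simp add: As1_gen.abs_eq h ev)
  have uniq: "h1 = h" if "?P h1" for h1
  proof
    fix a
    have p: "Vector_Spaces.linear As1_scale scale h1" using that by blast
    have z: "h1 0 = 0" "h 0 = 0"
      using p lin by (metis Vector_Spaces.linear_iff add_cancel_right_right)+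
    show "h1 a = h a"
      by (induction a rule: As1_induct)
        (use that z lin mult gen in \<open>simp_all add: Vector_Spaces.linear_iff\<close>)
  qed
  show ?thesis
  proof (rule ex1I)
    show "?P h" using lin mult gen by blast
    show "h1 = h" if "?P h1" for h1 using that by (rule uniq)
  qed
qed

end

theory Submission
  imports Defs "HOL-Combinatorics.Multiset_Permutations"
begin

text \<open>
  Write $J$ for the T-ideal generated by commutativity, the Jacobi identity and the quartic
  identity. That these three identities hold is a direct expansion, because the defining
  identity of the variety says that the sum of the products of three elements in all orders
  vanishes. The content of the theorem is that an identity \<open>f\<close> of degree at most four lies in
  $J$. It rests on three ideas.

  \<^emph>\<open>Left-normed products.\<close> Commutativity and Jacobi give
  $u(vw) = -(uv)w - (uw)v$ modulo $J$. Hence every monomial is congruent to a combination of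
  left-normed monomials $((v_1v_2)v_3)\cdots$ of the same length, and \<open>f\<close> may be taken to be
  $\sum_l \alpha_l\, l$, where \<open>l\<close> runs through lists of variables
  (\<open>leftnormed_class_total_degree\<close>).

  \<^emph>\<open>Polarization.\<close> Fix \<open>p\<close>, which assigns variables to the labels $0,\dots,d-1$, and elements
  $x_0,\dots,x_{d-1}$ of the algebra. Substituting for each variable \<open>v\<close> the sum of those $x_s$
  with $s \in S$ and $p(s) = v$, and comparing the subsets \<open>S\<close> of the labels, isolates the terms
  in which every label occurs exactly once: if \<open>f\<close> is an identity of degree at most \<open>d\<close>, then
  $\sum_q \alpha_{p(q)}\, x_q = 0$, where \<open>q\<close> runs through the permutations of the labels
  (\<open>polarization\<close>). This is a multilinear identity. Once the multilinear identities are known to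
  lie in $J$, put $x_s = p(s)$ and sum over all \<open>p\<close>: the component of \<open>f\<close> of degree \<open>d\<close> is counted
  $d!$ times, so it lies in $J$ (\<open>leftnormed_part_in_ideal\<close>). Subtracting it lowers the degree.

  \<^emph>\<open>One linear form.\<close> By the theorem of Nagata and Higman the free first-type algebra is
  nilpotent and has no elements of degree six, but its component of degree three in \<open>x\<close> and two in
  another generator \<open>y\<close> is not zero; it is one-dimensional. The linear form on it is enough to
  detect all multilinear identities of degree at most four, when products of the
  generators are substituted for the variables (\<open>multilinear_identity\<close>). In degree four, modulo
  $J$, the twelve products $((ab)c)d$ that are left by commutativity span a space of dimension at
  most five, and substituting $x, x, y, xy$ in various orders gives five independent linear
  conditions on the coefficients of an identity. Substituting generators alone would not do, since
  some multilinear elements of degree four vanish whenever two generators are substituted for the four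
  variables.
\<close>

section \<open>A linear form on the degree-five part of the free first-type algebra\<close>

primrec leaves :: "'v magma \<Rightarrow> 'v list" where
  "leaves (MVar v) = [v]"
| "leaves (MOp s t) = leaves s @ leaves t"

lemma leaves_nonempty [simp]: "leaves m \<noteq> []"
  by (induction m) auto

text \<open>View a word with three letters \<open>x\<close> (written \<open>True\<close>) and two letters \<open>y\<close> as an
  arrangement of four letters $x^2, x, y, y$. Its weight depends on the distance between $x^2$
  and \<open>x\<close>: it is zero if they are neighbours, $\pm 1$ if they are two places apart and
  $\mp 1$ if they are three places apart, with the upper sign if $x^2$ comes first. Words that
  are not of this form have weight zero. Up to a scalar this is the only linear form
  on words with three \<open>x\<close> and two \<open>y\<close> that vanishes on all consequences of the defining identity.\<close>

definition word_weight :: "bool list \<Rightarrow> int" where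
  "word_weight w =
    (if w \<in> {[True,True,False,True,False], [True,False,False,True,True], [False,True,True,False,True]} then 1
     else if w \<in> {[True,True,False,False,True], [True,False,True,True,False], [False,True,False,True,True]} then -1
     else 0)"

lemma word_weight_length: "length w \<noteq> 5 \<Longrightarrow> word_weight w = 0"
  by (auto simp: word_weight_def)

text \<open>The weight is supported on words of length five, which leaves finitely many ways to choose
  the factors, and the statement is checked on each of them.\<close>

lemma word_weight_first_type:
  assumes "a \<noteq> []" "b \<noteq> []" "c \<noteq> []"
  shows "word_weight (p @ a @ b @ c @ q) + word_weight (p @ b @ a @ c @ q)
       + word_weight (p @ a @ c @ b @ q) + word_weight (p @ c @ a @ b @ q)
       + word_weight (p @ b @ c @ a @ q) + word_weight (p @ c @ b @ a @ q) = 0"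
    (is "?S p a b c q = 0")
proof (cases "length (p @ a @ b @ c @ q) = 5")
  case False
  then show ?thesis by (simp add: word_weight_length)
next
  case True
  let ?W = "\<lambda>n. List.n_lists n [True, False]"
  have mem: "xs \<in> set (?W n)" if "length xs = n" for xs n
    using that by (auto simp: set_n_lists)
  \<comment> \<open>\<open>i, j, k, l\<close> are the lengths of \<open>p, a, b, c\<close>; since \<open>a, b, c\<close> are nonempty, these bounds
    cover all decompositions of a word of length five.\<close>
  have "\<forall>i\<in>{0,1,2}. \<forall>j\<in>{1,2,3}. \<forall>k\<in>{1,2,3}. \<forall>l\<in>{1,2,3}. i + j + k + l \<le> 5 \<longrightarrow>
      (\<forall>w\<in>set (?W 5).
        let p = take i w; w1 = drop i w; a = take j w1; w2 = drop j w1; b = take k w2; w3 = drop k w2;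
            c = take l w3; q = drop l w3 in ?S p a b c q = 0)"
    by code_simp
  moreover have "length p \<in> {0,1,2}" "length a \<in> {1,2,3}" "length b \<in> {1,2,3}" "length c \<in> {1,2,3}"
    using True assms by (auto simp flip: length_greater_0_conv)
  moreover have "length p + length a + length b + length c \<le> 5" using True by simp
  moreover note mem[OF True]
  ultimately have "let w = p @ a @ b @ c @ q; p' = take (length p) w; w1 = drop (length p) w;
            a' = take (length a) w1; w2 = drop (length a) w1; b' = take (length b) w2; w3 = drop (length b) w2;
            c' = take (length c) w3; q' = drop (length c) w3 in ?S p' a' b' c' q' = 0"
    unfolding Let_def by blast
  then show ?thesis by (simp add: Let_def)
qed

text \<open>Unlike evaluation in an algebra, the weights \<open>c\<close> need not be compatible with products; the
  formula for products below peels off one factor at a time instead.\<close>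

definition extend_linearly :: "('v magma \<Rightarrow> 'k) \<Rightarrow> ('v, 'k::field) nonassoc \<Rightarrow> 'k" where
  "extend_linearly c f = (\<Sum>m\<in>Poly_Mapping.keys f. Poly_Mapping.lookup f m * c m)"

lemma extend_linearly_superset:
  assumes "finite A" "Poly_Mapping.keys f \<subseteq> A"
  shows "extend_linearly c f = (\<Sum>m\<in>A. Poly_Mapping.lookup f m * c m)"
  unfolding extend_linearly_def using assms
  by (intro sum.mono_neutral_left) (auto simp: in_keys_iff)

lemma extend_linearly_add: "extend_linearly c (f + g) = extend_linearly c f + extend_linearly c g"
proof -
  have "Poly_Mapping.keys (f + g) \<subseteq> Poly_Mapping.keys f \<union> Poly_Mapping.keys g" by (rule Poly_Mapping.keys_add)
  then show ?thesis
    by (simp add: extend_linearly_superset[of "Poly_Mapping.keys f \<union> Poly_Mapping.keys g"]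
        lookup_add distrib_right sum.distrib)
qed

lemma extend_linearly_zero [simp]: "extend_linearly c 0 = 0"
  by (simp add: extend_linearly_def)

lemma extend_linearly_nscale: "extend_linearly c (nscale r f) = r * extend_linearly c f"
  unfolding extend_linearly_superset[OF finite_keys keys_nscale, of c r f]
  by (simp add: extend_linearly_def sum_distrib_left mult.assoc)

lemma extend_linearly_diff: "extend_linearly c (f - g) = extend_linearly c f - extend_linearly c g"
  by (metis add_diff_cancel diff_add_cancel extend_linearly_add)

lemma extend_linearly_single: "extend_linearly c (Poly_Mapping.single m r) = r * c m"
  by (simp add: extend_linearly_superset[of "{m}"])

lemma extend_linearly_sum: "extend_linearly c (\<Sum>i\<in>A. f i) = (\<Sum>i\<in>A. extend_linearly c (f i))"
  by (induction A rule: infinite_finite_induct) (auto simp: extend_linearly_add)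

lemma extend_linearly_nprod:
  "extend_linearly c (f \<odot> g) = extend_linearly (\<lambda>s. extend_linearly (\<lambda>t. c (MOp s t)) g) f"
  unfolding nprod_def extend_linearly_sum extend_linearly_single
  by (simp add: extend_linearly_def sum_distrib_left mult.assoc)

lemma extend_linearly_swap:
  "extend_linearly (\<lambda>s. extend_linearly (F s) g) f = extend_linearly (\<lambda>t. extend_linearly (\<lambda>s. F s t) f) g"
  unfolding extend_linearly_def sum_distrib_left
  by (subst sum.swap) (simp add: mult.left_commute)

lemma extend_linearly_pointwise_add:
  "extend_linearly (\<lambda>m. c m + d m) f = extend_linearly c f + extend_linearly d f"
  by (simp add: extend_linearly_def sum.distrib distrib_left)

lemma extend_linearly_zero_weight: "(\<And>m. c m = 0) \<Longrightarrow> extend_linearly c f = 0"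
  by (simp add: extend_linearly_def)

text \<open>The words \<open>p\<close> and \<open>q\<close> surround the word spelled by the monomial. They make it possible to
  express the weight of a product through its factors, and so to see that the elements without
  weight in any surrounding form an ideal. All generators other than \<open>x\<close> count as \<open>y\<close>.\<close>

definition magma_weight :: "'x \<Rightarrow> bool list \<Rightarrow> bool list \<Rightarrow> 'x magma \<Rightarrow> 'k::field" where
  "magma_weight x p q m = of_int (word_weight (p @ map (\<lambda>v. v = x) (leaves m) @ q))"

lemma magma_weight_MOp:
  "magma_weight x p q (MOp s t) = magma_weight x p (map (\<lambda>v. v = x) (leaves t) @ q) s"
  "magma_weight x p q (MOp s t) = magma_weight x (p @ map (\<lambda>v. v = x) (leaves s)) q t"
  by (simp_all add: magma_weight_def)

text \<open>The associator has no weight because the weight of a monomial depends only on the word of its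
  leaves; the symmetrized product has none by trilinearity and \<open>word_weight_first_type\<close>.\<close>

lemma As1_ideal_weightless:
  fixes f :: "('x, 'k::field) nonassoc"
  assumes "f \<in> As1_ideal"
  shows "extend_linearly (magma_weight x p q) f = 0"
proof -
  define N where "N = {f :: ('x, 'k) nonassoc. \<forall>p q. extend_linearly (magma_weight x p q) f = 0}"
  have "As1_relators \<subseteq> N"
  proof -
    have "extend_linearly (magma_weight x p q) (a \<odot> b \<odot> c - a \<odot> (b \<odot> c)) = 0"
      for a b c :: "('x, 'k) nonassoc" and p q
      by (simp add: extend_linearly_diff extend_linearly_nprod magma_weight_def)
    moreover have "extend_linearly (magma_weight x p q)
        (a \<odot> b \<odot> c + b \<odot> a \<odot> c + a \<odot> c \<odot> b + c \<odot> a \<odot> b + b \<odot> c \<odot> a + c \<odot> b \<odot> a) = 0"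
 for a b c :: "('x, 'k) nonassoc" and p q
    proof -
      define F :: "'x magma \<Rightarrow> 'x magma \<Rightarrow> 'x magma \<Rightarrow> 'k"
        where "F = (\<lambda>r s t. magma_weight x p q (MOp (MOp r s) t))"
      let ?e = "extend_linearly (magma_weight x p q)"
      let ?E = "\<lambda>G. extend_linearly (\<lambda>r. extend_linearly (\<lambda>s. extend_linearly (G r s) c) b) a"
      \<comment> \<open>Expand all six products over monomials \<open>r, s, t\<close> of \<open>a, b, c\<close>, always in this order.\<close>
      have e: "?e (a \<odot> b \<odot> c) = ?E F"
        by (simp add: extend_linearly_nprod F_def)
      have "?e (b \<odot> a \<odot> c) = ?E (\<lambda>r s t. F s r t)"
        by (simp add: extend_linearly_nprod F_def) (rule extend_linearly_swap)
      moreover have "?e (a \<odot> c \<odot> b) = ?E (\<lambda>r s t. F r t s)"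
        by (simp add: extend_linearly_nprod F_def) (subst extend_linearly_swap[of _ b c], rule refl)
      moreover have "?e (c \<odot> a \<odot> b) = ?E (\<lambda>r s t. F t r s)"
        by (simp add: extend_linearly_nprod F_def)
           (subst extend_linearly_swap[of _ a c], subst extend_linearly_swap[of _ b c], rule refl)
      moreover have "?e (b \<odot> c \<odot> a) = ?E (\<lambda>r s t. F s t r)"
        by (simp add: extend_linearly_nprod F_def)
           (subst extend_linearly_swap[of _ a c], subst extend_linearly_swap[of _ a b], rule refl)
      moreover have "?e (c \<odot> b \<odot> a) = ?E (\<lambda>r s t. F t s r)"
        by (simp add: extend_linearly_nprod F_def)
           (subst extend_linearly_swap[of _ a b], subst extend_linearly_swap[of _ a c],
            subst extend_linearly_swap[of _ b c], rule refl)
      moreover have "?E (\<lambda>r s t. F r s t + F s r t + F r t s + F t r s + F s t r + F t s r) = 0"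
      proof (intro extend_linearly_zero_weight)
        fix r s t
        show "F r s t + F s r t + F r t s + F t r s + F s t r + F t s r = 0"
          unfolding F_def magma_weight_def of_int_add[symmetric]
          using word_weight_first_type[of "map (\<lambda>v. v = x) (leaves r)" "map (\<lambda>v. v = x) (leaves s)"
              "map (\<lambda>v. v = x) (leaves t)" p q]
          by simp
      qed
      ultimately show ?thesis using e
        by (simp add: extend_linearly_add extend_linearly_pointwise_add)
    qed
    ultimately show ?thesis by (auto simp: As1_relators_def N_def)
  qed
  moreover have "nideal N"
    unfolding nideal_def
  proof (intro conjI ballI allI)
    fix f g :: "('x, 'k) nonassoc"
    assume f: "f \<in> N"
    show "g \<odot> f \<in> N"
      using f by (simp add: N_def extend_linearly_nprod magma_weight_MOp(2) extend_linearly_zero_weight)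
    have "extend_linearly (magma_weight x p q) (f \<odot> g) = 0" for p q
      unfolding extend_linearly_nprod extend_linearly_swap[of _ g f]
      using f by (simp add: N_def magma_weight_MOp(1) extend_linearly_zero_weight)
    then show "f \<odot> g \<in> N" by (simp add: N_def)
  qed (auto simp: N_def extend_linearly_add extend_linearly_nscale)
  ultimately have "As1_ideal \<subseteq> N" unfolding As1_ideal_def by (rule hull_minimal)
  then show ?thesis using assms by (auto simp: N_def)
qed

lift_definition As1_weight :: "'x \<Rightarrow> ('x, 'k::field) As1 \<Rightarrow> 'k"
  is "\<lambda>x. extend_linearly (magma_weight x [] [])"
proof -
  fix x :: 'x and f g :: "('x, 'k) nonassoc"
  assume "As1_rel f g"
  then show "extend_linearly (magma_weight x [] []) f = extend_linearly (magma_weight x [] []) g"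
    using As1_ideal_weightless[of "f - g" x "[]" "[]"]
    by (simp add: As1_rel_def extend_linearly_diff)
qed

lemma As1_weight_add: "As1_weight x (a + b) = As1_weight x a + As1_weight x b"
  by transfer (rule extend_linearly_add)

lemma As1_weight_zero [simp]: "As1_weight x 0 = 0"
  by transfer simp

lemma As1_weight_scale: "As1_weight x (As1_scale c a) = c * As1_weight x a"
  by transfer (rule extend_linearly_nscale)

lemma As1_weight_sum: "As1_weight x (\<Sum>i\<in>A. f i) = (\<Sum>i\<in>A. As1_weight x (f i))"
  by (induction A rule: infinite_finite_induct) (auto simp: As1_weight_add)

lemma As1_weight_word:
  "As1_weight x (As1_gen a * (As1_gen b * (As1_gen c * (As1_gen d * As1_gen e)))) =
   of_int (word_weight [a = x, b = x, c = x, d = x, e = x])"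
  by transfer (simp add: extend_linearly_nprod nvar_def extend_linearly_single magma_weight_def)

context
  fixes x y :: 'x and X Y :: "('x, 'k::field) As1"
  assumes xy: "x \<noteq> y" and X: "X = As1_gen x" and Y: "Y = As1_gen y"
begin

lemmas weight_simps = anticommutator_def distrib_left distrib_right mult.assoc As1_weight_add
  As1_weight_word word_weight_def xy[symmetric]

text \<open>The substitutions that are used to detect multilinear identities of degree one to four. Each
  multiplies out to a combination of words with three \<open>X\<close> and two \<open>Y\<close>; the elements $X^2Y^2$, $XY^2$
  and \<open>XY\<close> raise the degree of the product to five.\<close>

lemma weight_degree_1: "As1_weight x (X * (X * (Y * (X * Y)))) = 1"
  by (simp add: X Y weight_simps)

lemma weight_degree_2: "As1_weight x (anticommutator X (X * (X * (Y * Y)))) = - 1"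
  "As1_weight x (anticommutator (X * (X * (Y * Y))) X) = - 1"
  by (simp_all add: X Y weight_simps)

lemma weight_degree_3:
  "As1_weight x (anticommutator (anticommutator X X) (X * (Y * Y))) = 2"
  "As1_weight x (anticommutator (anticommutator X (X * (Y * Y))) X) = - 1"
  "As1_weight x (anticommutator (anticommutator (X * (Y * Y)) X) X) = - 1"
  by (simp_all add: X Y weight_simps)

lemma weight_degree_4:
  "As1_weight x (anticommutator (anticommutator (anticommutator X X) Y) (X * Y)) = 2"
  "As1_weight x (anticommutator (anticommutator (anticommutator X X) (X * Y)) Y) = - 4"
  "As1_weight x (anticommutator (anticommutator (anticommutator X Y) X) (X * Y)) = - 1"
  "As1_weight x (anticommutator (anticommutator (anticommutator X Y) (X * Y)) X) = 2"
  "As1_weight x (anticommutator (anticommutator (anticommutator X (X * Y)) X) Y) = 2"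
  "As1_weight x (anticommutator (anticommutator (anticommutator X (X * Y)) Y) X) = - 1"
  "As1_weight x (anticommutator (anticommutator (anticommutator Y (X * Y)) X) X) = - 1"
  by (simp_all add: X Y weight_simps)

end

section \<open>Left-normed products and polarization\<close>

text \<open>The product $((a_1a_2)a_3)\cdots$; its value on the empty list is meaningless. The operation is
  a parameter so that the same notion serves for elements of an algebra, for nonassociative
  polynomials and for monomials.\<close>

definition leftnormed :: "('a \<Rightarrow> 'a \<Rightarrow> 'a) \<Rightarrow> 'a list \<Rightarrow> 'a" where
  "leftnormed opr xs = foldl opr (hd xs) (tl xs)"

lemma leftnormed_singleton [simp]: "leftnormed opr [a] = a"
  by (simp add: leftnormed_def)

lemma leftnormed_snoc: "xs \<noteq> [] \<Longrightarrow> leftnormed opr (xs @ [a]) = opr (leftnormed opr xs) a"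
  by (simp add: leftnormed_def)

definition leftnormed_monomial :: "'v list \<Rightarrow> 'v magma" where
  "leftnormed_monomial l = leftnormed MOp (map MVar l)"

definition leftnormed_monomials :: "nat \<Rightarrow> 'v magma set" where
  "leftnormed_monomials d = leftnormed_monomial ` {l. l \<noteq> [] \<and> length l \<le> d}"

lemma leftnormed_monomial_singleton: "leftnormed_monomial [v] = MVar v"
  by (simp add: leftnormed_monomial_def)

lemma leftnormed_monomial_snoc:
  "l \<noteq> [] \<Longrightarrow> leftnormed_monomial (l @ [v]) = MOp (leftnormed_monomial l) (MVar v)"
  by (simp add: leftnormed_monomial_def leftnormed_snoc)

lemma eval_leftnormed_monomial:
  "l \<noteq> [] \<Longrightarrow> eval_monomial opr \<sigma> (leftnormed_monomial l) = leftnormed opr (map \<sigma> l)"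
  by (induction l rule: rev_nonempty_induct)
     (simp_all add: leftnormed_snoc leftnormed_monomial_singleton leftnormed_monomial_snoc)

lemma leaves_leftnormed_monomial: "l \<noteq> [] \<Longrightarrow> leaves (leftnormed_monomial l) = l"
  by (induction l rule: rev_nonempty_induct)
     (simp_all add: leftnormed_monomial_singleton leftnormed_monomial_snoc)

lemma leftnormed_monomial_eq_iff [simp]:
  "l \<noteq> [] \<Longrightarrow> l' \<noteq> [] \<Longrightarrow> leftnormed_monomial l = leftnormed_monomial l' \<longleftrightarrow> l = l'"
  by (metis leaves_leftnormed_monomial)

lemma (in nonassoc_algebra) opr_zero: "opr 0 a = 0" "opr a 0 = 0"
  using opr_add_left[of 0 0 a] opr_add_right[of a 0 0] by auto

text \<open>Multiplying out: \<open>q\<close> records which summand is chosen in each factor. A choice of labels \<open>q\<close>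
  determines the list of variables as \<open>map p q\<close>, which is why \<open>p\<close> need not be injective.\<close>

lemma (in nonassoc_algebra) leftnormed_sums:
  assumes "l \<noteq> []"
  shows "leftnormed opr (map (\<lambda>v. \<Sum>s\<in>{s\<in>S. p s = v}. x s) l) =
    (\<Sum>q\<in>{q. set q \<subseteq> S \<and> map p q = l}. leftnormed opr (map x q))"
  using assms
proof (induction l rule: rev_nonempty_induct)
  case (single v)
  have "{q. set q \<subseteq> S \<and> map p q = [v]} = (\<lambda>s. [s]) ` {s\<in>S. p s = v}"
    by (auto simp: map_eq_Cons_conv)
  then show ?case by (simp add: sum.reindex inj_on_def)
next
  case (snoc v l)
  have l: "opr (\<Sum>i\<in>A. F i) b = (\<Sum>i\<in>A. opr (F i) b)" for A :: "'i set" and F b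
    by (induction A rule: infinite_finite_induct) (auto simp: opr_zero opr_add_left)
  have r: "opr b (\<Sum>i\<in>A. F i) = (\<Sum>i\<in>A. opr b (F i))" for A :: "'i set" and F b
    by (induction A rule: infinite_finite_induct) (auto simp: opr_zero opr_add_right)
  let ?Q = "{q. set q \<subseteq> S \<and> map p q = l}" and ?s = "{s\<in>S. p s = v}"
  have ne: "q \<noteq> []" if "q \<in> ?Q" for q using that snoc.hyps by auto
  have split: "{q. set q \<subseteq> S \<and> map p q = l @ [v]} = (\<lambda>(q, s). q @ [s]) ` (?Q \<times> ?s)"
  proof (intro equalityI subsetI)
    fix q assume q: "q \<in> {q. set q \<subseteq> S \<and> map p q = l @ [v]}"
    then obtain q' s where "q = q' @ [s]" by (cases q rule: rev_cases) auto
    then show "q \<in> (\<lambda>(q, s). q @ [s]) ` (?Q \<times> ?s)" using q by (auto simp: image_iff)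
  qed auto
  have "leftnormed opr (map (\<lambda>v. \<Sum>s\<in>{s\<in>S. p s = v}. x s) (l @ [v])) =
      opr (\<Sum>q\<in>?Q. leftnormed opr (map x q)) (\<Sum>s\<in>?s. x s)"
    using snoc by (simp add: leftnormed_snoc)
  also have "\<dots> = (\<Sum>(q, s)\<in>?Q \<times> ?s. leftnormed opr (map x (q @ [s])))"
    unfolding l unfolding r sum.cartesian_product
    by (intro sum.cong refl) (auto simp: leftnormed_snoc ne)
  also have "\<dots> = (\<Sum>q\<in>{q. set q \<subseteq> S \<and> map p q = l @ [v]}. leftnormed opr (map x q))"
    unfolding split by (subst sum.reindex) (auto simp: inj_on_def case_prod_unfold)
  finally show ?case .
qed

text \<open>The qualitative part of Moebius inversion on the lattice of finite subsets.\<close>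

lemma zero_sum_over_exact_subset:
  fixes h :: "'a set \<Rightarrow> 'b::ab_group_add"
  assumes "\<And>S. finite S \<Longrightarrow> (\<Sum>T\<in>Pow S. h T) = 0" and "finite S"
  shows "h S = 0"
  using assms(2)
proof (induction S rule: finite_psubset_induct)
  case (psubset S)
  have "(\<Sum>T\<in>Pow S. h T) = h S + (\<Sum>T\<in>Pow S - {S}. h T)"
    using psubset.hyps by (intro sum.remove) auto
  also have "(\<Sum>T\<in>Pow S - {S}. h T) = 0"
    by (intro sum.neutral) (auto intro!: psubset.IH)
  finally show ?case using assms(1)[OF psubset.hyps] by simp
qed

text \<open>Substitute the sum of the \<open>x s\<close> with \<open>s \<in> S\<close> and \<open>p s = v\<close> for each variable \<open>v\<close>. The value of \<open>g\<close>
  becomes a sum over lists \<open>q\<close> of labels from \<open>S\<close>, and it vanishes for every finite \<open>S\<close>. So the terms whose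
  labels are exactly the elements of \<open>S\<close> cancel among themselves, and if \<open>S\<close> has as many elements as the degree
  allows, these are the permutations of \<open>S\<close>. Terms of lower degree drop out because they carry too few labels.\<close>

lemma (in nonassoc_algebra) polarization:
  fixes g :: "(nat, 'k) nonassoc" and p :: "nat \<Rightarrow> nat" and x :: "nat \<Rightarrow> 'a"
  assumes g: "Poly_Mapping.keys g \<subseteq> leftnormed_monomials d" and id: "is_identity scale opr g"
    and S: "finite S" "card S = d"
  shows "(\<Sum>q\<in>permutations_of_set S.
      scale (Poly_Mapping.lookup g (leftnormed_monomial (map p q))) (leftnormed opr (map x q))) = 0"
proof -
  let ?\<alpha> = "\<lambda>l. Poly_Mapping.lookup g (leftnormed_monomial l)"
  define summand where "summand q = scale (?\<alpha> (map p q)) (leftnormed opr (map x q))" for q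
  define Q where "Q S = {q. q \<noteq> [] \<and> length q \<le> d \<and> set q = S}" for S :: "nat set"
  have fin: "finite {q. q \<noteq> [] \<and> length q \<le> d \<and> set q \<subseteq> S}" if "finite S" for S :: "nat set"
    by (rule finite_subset[OF _ finite_lists_length_le[OF that, of d]]) auto
  have vanish: "(\<Sum>T\<in>Pow S. \<Sum>q\<in>Q T. summand q) = 0" if S: "finite S" for S
  proof -
    let ?\<sigma> = "\<lambda>v. \<Sum>s\<in>{s\<in>S. p s = v}. x s"
    let ?QS = "{q. q \<noteq> [] \<and> length q \<le> d \<and> set q \<subseteq> S}"
    let ?L = "{l. l \<noteq> [] \<and> leftnormed_monomial l \<in> Poly_Mapping.keys g}"
    have len: "length l \<le> d" if "l \<in> ?L" for l
      using that g by (auto simp: leftnormed_monomials_def)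
    have inj: "inj_on leftnormed_monomial ?L" by (auto intro!: inj_onI)
    have keys: "Poly_Mapping.keys g = leftnormed_monomial ` ?L"
      using g by (auto simp: leftnormed_monomials_def)
    have finL: "finite ?L" using finite_keys[of g] by (subst (asm) keys) (rule finite_imageD[OF _ inj])
    have finS: "finite {q \<in> ?QS. map p q = l}" for l
      by (rule finite_subset[OF _ fin[OF S]]) auto
    \<comment> \<open>Once the labels \<open>q\<close> are chosen, the monomial is determined, so the double sum is a single one.\<close>
    have "0 = evaluate scale opr ?\<sigma> g" using id by (simp add: is_identity_def)
    also have "\<dots> = (\<Sum>l\<in>?L. scale (?\<alpha> l) (leftnormed opr (map ?\<sigma> l)))"
      unfolding evaluate_def
      by (rule sum.reindex_cong[OF inj keys]) (simp add: eval_leftnormed_monomial)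
    also have "\<dots> = (\<Sum>l\<in>?L. \<Sum>q\<in>{q\<in>?QS. map p q = l}. summand q)"
    proof (intro sum.cong refl)
      fix l assume l: "l \<in> ?L"
      then have "{q \<in> ?QS. map p q = l} = {q. set q \<subseteq> S \<and> map p q = l}" using len[OF l] by auto
      then show "scale (?\<alpha> l) (leftnormed opr (map ?\<sigma> l)) = (\<Sum>q\<in>{q\<in>?QS. map p q = l}. summand q)"
        using l S by (simp add: leftnormed_sums scale_sum_right summand_def)
    qed
    also have "\<dots> = (\<Sum>q\<in>(\<Union>l\<in>?L. {q\<in>?QS. map p q = l}). summand q)"
      by (rule sum.UNION_disjoint[symmetric]) (use finL finS in auto)
    also have "\<dots> = (\<Sum>q\<in>?QS. summand q)"
      using fin[OF S] by (intro sum.mono_neutral_left) (auto simp: summand_def in_keys_iff)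
    also have "?QS = (\<Union>T\<in>Pow S. Q T)" by (auto simp: Q_def)
    also have "(\<Sum>q\<in>(\<Union>T\<in>Pow S. Q T). summand q) = (\<Sum>T\<in>Pow S. \<Sum>q\<in>Q T. summand q)"
    proof (rule sum.UNION_disjoint)
      show "\<forall>T\<in>Pow S. finite (Q T)"
        using fin[OF S] by (auto simp: Q_def intro: rev_finite_subset)
    qed (use S in \<open>auto simp: Q_def\<close>)
    finally show ?thesis by simp
  qed
  have "(\<Sum>q\<in>Q S. summand q) = 0"
    by (rule zero_sum_over_exact_subset[where h = "\<lambda>T. \<Sum>q\<in>Q T. summand q", OF vanish S(1)])
  also have "(\<Sum>q\<in>Q S. summand q) = (\<Sum>q\<in>permutations_of_set S. summand q)"
  proof (rule sum.mono_neutral_cong)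
    show "finite (Q S)"
      using fin[OF S(1)] by (auto simp: Q_def intro: rev_finite_subset)
    fix q
    assume q: "q \<in> Q S - permutations_of_set S"
    then have "set q = S" "length q \<le> card (set q)" using S by (auto simp: Q_def)
    then have "distinct q" using card_length[of q] by (intro card_distinct) simp
    then show "summand q = 0"
      using q \<open>set q = S\<close> by (simp add: permutations_of_set_def)
  next
    fix q assume q: "q \<in> permutations_of_set S - Q S"
    then have "set q = S" "length q = d"
      using S distinct_card[of q] by (simp_all add: permutations_of_set_def)
    then have "d = 0" using q by (simp add: Q_def)
    then have "Poly_Mapping.keys g = {}" using g by (simp add: leftnormed_monomials_def)
    then show "summand q = 0" by (simp add: summand_def)
  qed (auto)
  finally show ?thesis by (simp add: summand_def)
qed

section \<open>The T-ideal generated by the three identities\<close>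

context nonassoc_algebra
begin

lemma evaluate_nsubst:
  "evaluate scale opr \<sigma> (nsubst \<tau> f) = evaluate scale opr (\<lambda>v. evaluate scale opr \<sigma> (\<tau> v)) f"
proof -
  have "evaluate scale opr \<sigma> (eval_monomial nprod \<tau> m) = eval_monomial opr (\<lambda>v. evaluate scale opr \<sigma> (\<tau> v)) m" for m
    by (induction m) (simp_all add: evaluate_nprod)
  then show ?thesis
    by (simp add: nsubst_def evaluate_def[of nscale] evaluate_sum evaluate_nscale)
       (simp add: evaluate_def)
qed

lemma T_ideal_identities: "T_ideal {f. is_identity scale opr f}"
  by (auto simp: T_ideal_def nideal_def is_identity_def evaluate_add evaluate_nscale evaluate_nprod
      evaluate_nsubst opr_zero)

end

interpretation magmatic: nonassoc_algebra nscale nprod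
  by (intro nonassoc_algebra.intro nonassoc_algebra_axioms.intro nscale_vector_space nprod_add_left nprod_add_right
      nprod_nscale_left nprod_nscale_right)

interpretation As1_plus: nonassoc_algebra As1_scale anticommutator
proof (intro nonassoc_algebra.intro nonassoc_algebra_axioms.intro As1_scale_vector_space)
  fix r :: 'a and a b :: "('b, 'a) As1"
  interpret vector_space "As1_scale :: 'a \<Rightarrow> ('b, 'a) As1 \<Rightarrow> _" by (rule As1_scale_vector_space)
  show "anticommutator (As1_scale r a) b = As1_scale r (anticommutator a b)"
    "anticommutator a (As1_scale r b) = As1_scale r (anticommutator a b)"
    by (simp_all add: anticommutator_def As1_scale_mult scale_right_distrib)
qed (simp_all add: anticommutator_def algebra_simps)

text \<open>Each of the six products of \<open>a\<close>, \<open>b\<close>, \<open>c\<close> occurs exactly twice.\<close>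

lemma first_type_jacobi:
  fixes a b c :: "'a::ring"
  assumes "\<And>a b c::'a. a * b * c + b * a * c + a * c * b + c * a * b + b * c * a + c * b * a = 0"
  shows "anticommutator a (anticommutator b c) + anticommutator b (anticommutator c a)
    + anticommutator c (anticommutator a b) = 0"
proof -
  let ?s = "a * b * c + b * a * c + a * c * b + c * a * b + b * c * a + c * b * a"
  have "anticommutator a (anticommutator b c) + anticommutator b (anticommutator c a)
    + anticommutator c (anticommutator a b) = ?s + ?s"
    by (simp add: anticommutator_def algebra_simps)
  then show ?thesis by (simp add: assms)
qed

text \<open>If \<open>L\<close> and \<open>R\<close> are left and right multiplication by \<open>y\<close>, then the case $b = c = d = y$ concerns
  $(L + R)^3 a = y^3a + 3(y^2ay + yay^2) + ay^3$, where $y^3 = 0$, and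
  $y^2ay + yay^2 = (y^2a + yay + ay^2)y - ay^3$ vanishes as well. The proof is the linearized form of
  this computation.\<close>

lemma first_type_quartic:
  fixes a b c d :: "'a::ring"
  assumes first: "\<And>a b c::'a. a * b * c + b * a * c + a * c * b + c * a * b + b * c * a + c * b * a = 0"
  defines "A \<equiv> (anticommutator :: 'a \<Rightarrow> 'a \<Rightarrow> 'a)"
  shows "A (A (A a b) c) d + A (A (A a b) d) c + A (A (A a c) b) d
    + A (A (A a c) d) b + A (A (A a d) b) c + A (A (A a d) c) b = 0"
proof -
  let ?S = "\<lambda>a b c. a * b * c + b * a * c + a * c * b + c * a * b + b * c * a + c * b * a"
  let ?T = "?S a b c * d + ?S a b d * c + ?S a c d * b"
  have "A (A (A a b) c) d + A (A (A a b) d) c + A (A (A a c) b) d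
      + A (A (A a c) d) b + A (A (A a d) b) c + A (A (A a d) c) b
    = ?S b c d * a + (?T + ?T + ?T) + a * ?S b c d - (a * ?S b c d + a * ?S b c d + a * ?S b c d)"
    unfolding A_def anticommutator_def
    by (simp add: algebra_simps)
  then show ?thesis by (simp add: first)
qed

text \<open>Commutative algebras satisfying the Jacobi identity are known as mock-Lie or Jacobi-Jordan algebras.\<close>

definition mock_lie_ideal :: "(nat, 'k::field) nonassoc set" where
  "mock_lie_ideal = T_ideal hull {commutativity, jacobi_identity, quartic_identity}"

lemma defining_identities_hold:
  assumes "g \<in> {commutativity, jacobi_identity, quartic_identity}"
  shows "is_identity (As1_scale :: 'k::field \<Rightarrow> ('x, 'k) As1 \<Rightarrow> _) anticommutator g"
proof -
  let ?id = "is_identity (As1_scale :: 'k \<Rightarrow> ('x, 'k) As1 \<Rightarrow> _) anticommutator"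
  note evaluate = Let_def As1_plus.evaluate_add As1_plus.evaluate_diff As1_plus.evaluate_nprod
  have "?id commutativity"
    by (simp add: is_identity_def commutativity_def evaluate anticommutator_def add.commute)
  moreover have "?id jacobi_identity"
    by (simp add: is_identity_def jacobi_identity_def evaluate first_type_jacobi[OF As1_first_type])
  moreover have "?id quartic_identity"
    by (simp add: is_identity_def quartic_identity_def evaluate first_type_quartic[OF As1_first_type])
  ultimately show ?thesis using assms by blast
qed

lemma mock_lie_ideal_identities:
  "f \<in> mock_lie_ideal \<Longrightarrow> is_identity (As1_scale :: 'k::field \<Rightarrow> ('x, 'k) As1 \<Rightarrow> _) anticommutator f"
  using hull_minimal[of "{commutativity, jacobi_identity, quartic_identity}"
     "{f. is_identity (As1_scale :: 'k \<Rightarrow> ('x, 'k) As1 \<Rightarrow> _) anticommutator f}" T_ideal]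
    As1_plus.T_ideal_identities defining_identities_hold
  unfolding mock_lie_ideal_def by blast

lemma mock_lie_ideal_intros:
  "0 \<in> mock_lie_ideal"
  "f \<in> mock_lie_ideal \<Longrightarrow> g \<in> mock_lie_ideal \<Longrightarrow> f + g \<in> mock_lie_ideal"
  "f \<in> mock_lie_ideal \<Longrightarrow> g \<in> mock_lie_ideal \<Longrightarrow> f - g \<in> mock_lie_ideal"
  "f \<in> mock_lie_ideal \<Longrightarrow> - f \<in> mock_lie_ideal"
  "f \<in> mock_lie_ideal \<Longrightarrow> nscale c f \<in> mock_lie_ideal"
  "f \<in> mock_lie_ideal \<Longrightarrow> f \<odot> g \<in> mock_lie_ideal"
  "f \<in> mock_lie_ideal \<Longrightarrow> g \<odot> f \<in> mock_lie_ideal"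
  using T_ideal_hull[of "{commutativity, jacobi_identity, quartic_identity}"]
    nideal_diff[of mock_lie_ideal] nideal_uminus[of mock_lie_ideal]
  unfolding mock_lie_ideal_def[symmetric] T_ideal_def nideal_def by auto

lemma mock_lie_ideal_sum: "(\<And>i. i \<in> A \<Longrightarrow> f i \<in> mock_lie_ideal) \<Longrightarrow> (\<Sum>i\<in>A. f i) \<in> mock_lie_ideal"
  by (induction A rule: infinite_finite_induct) (auto intro: mock_lie_ideal_intros)

lemma mock_lie_ideal_nsubst: "f \<in> mock_lie_ideal \<Longrightarrow> nsubst \<sigma> f \<in> mock_lie_ideal"
  using T_ideal_hull unfolding mock_lie_ideal_def T_ideal_def by blast

lemma mock_lie_commute: "a \<odot> b - b \<odot> a \<in> mock_lie_ideal"
proof -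
  have "(commutativity :: (nat, 'k::field) nonassoc) \<in> mock_lie_ideal"
    unfolding mock_lie_ideal_def by (rule hull_inc) simp
  from mock_lie_ideal_nsubst[OF this, of "\<lambda>v. if v = 0 then a else b"] show ?thesis
    by (simp add: commutativity_def Let_def nsubst_def magmatic.evaluate_diff magmatic.evaluate_nprod)
qed

lemma mock_lie_jacobi:
  "a \<odot> (b \<odot> c) + b \<odot> (c \<odot> a) + c \<odot> (a \<odot> b) \<in> mock_lie_ideal"
proof -
  have "(jacobi_identity :: (nat, 'k::field) nonassoc) \<in> mock_lie_ideal"
    unfolding mock_lie_ideal_def by (rule hull_inc) simp
  from mock_lie_ideal_nsubst[OF this, of "\<lambda>v. if v = 0 then a else if v = 1 then b else c"] show ?thesis
    by (simp add: jacobi_identity_def Let_def nsubst_def magmatic.evaluate_add magmatic.evaluate_nprod)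
qed

lemma mock_lie_left_jacobi:
  "(a \<odot> b) \<odot> c + (b \<odot> c) \<odot> a + (c \<odot> a) \<odot> b \<in> mock_lie_ideal"
proof -
  have "(a \<odot> b) \<odot> c + (b \<odot> c) \<odot> a + (c \<odot> a) \<odot> b =
   (a \<odot> (b \<odot> c) + b \<odot> (c \<odot> a) + c \<odot> (a \<odot> b)) - (a \<odot> (b \<odot> c) - (b \<odot> c) \<odot> a)
   - (b \<odot> (c \<odot> a) - (c \<odot> a) \<odot> b) - (c \<odot> (a \<odot> b) - (a \<odot> b) \<odot> c)" by simp
  then show ?thesis by (simp only: mock_lie_ideal_intros mock_lie_jacobi mock_lie_commute)
qed

text \<open>The rewriting rule that moves brackets to the left.\<close>

lemma mock_lie_flatten:
  "u \<odot> (v \<odot> w) + (u \<odot> v) \<odot> w + (u \<odot> w) \<odot> v \<in> mock_lie_ideal"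
proof -
  have "u \<odot> (v \<odot> w) + (u \<odot> v) \<odot> w + (u \<odot> w) \<odot> v =
   (u \<odot> (v \<odot> w) - (v \<odot> w) \<odot> u) + ((u \<odot> w) - (w \<odot> u)) \<odot> v
   + ((u \<odot> v) \<odot> w + (v \<odot> w) \<odot> u + (w \<odot> u) \<odot> v)"
    by (simp add: nprod_diff_left algebra_simps)
  then show ?thesis by (simp only: mock_lie_ideal_intros mock_lie_left_jacobi mock_lie_commute)
qed

text \<open>Both pairs of terms are equal to $-(ab)(cd)$ modulo the ideal.\<close>

lemma mock_lie_left_pairs:
  "((a \<odot> b) \<odot> c) \<odot> d + ((a \<odot> b) \<odot> d) \<odot> c - ((c \<odot> d) \<odot> a) \<odot> b - ((c \<odot> d) \<odot> b) \<odot> a \<in> mock_lie_ideal"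
proof -
  have "((a \<odot> b) \<odot> c) \<odot> d + ((a \<odot> b) \<odot> d) \<odot> c - ((c \<odot> d) \<odot> a) \<odot> b - ((c \<odot> d) \<odot> b) \<odot> a
    = ((a \<odot> b) \<odot> (c \<odot> d) + ((a \<odot> b) \<odot> c) \<odot> d + ((a \<odot> b) \<odot> d) \<odot> c)
    - ((c \<odot> d) \<odot> (a \<odot> b) + ((c \<odot> d) \<odot> a) \<odot> b + ((c \<odot> d) \<odot> b) \<odot> a)
    - ((a \<odot> b) \<odot> (c \<odot> d) - (c \<odot> d) \<odot> (a \<odot> b))"
    by simp
  then show ?thesis by (simp only: mock_lie_ideal_intros mock_lie_flatten mock_lie_commute)
qed

section \<open>Reduction to left-normed products\<close>

definition leftnormed_classes :: "nat \<Rightarrow> (nat, 'k::field) nonassoc set" where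
  "leftnormed_classes d = {f. \<exists>g. Poly_Mapping.keys g \<subseteq> leftnormed_monomials d \<and> f - g \<in> mock_lie_ideal}"

lemma leftnormed_classesI:
  "f - g \<in> mock_lie_ideal \<Longrightarrow> Poly_Mapping.keys g \<subseteq> leftnormed_monomials d \<Longrightarrow> f \<in> leftnormed_classes d"
  by (auto simp: leftnormed_classes_def)

lemma leftnormed_classes_add:
  assumes "f \<in> leftnormed_classes d" "f' \<in> leftnormed_classes d"
  shows "f + f' \<in> leftnormed_classes d"
proof -
  obtain g g' where g: "Poly_Mapping.keys g \<subseteq> leftnormed_monomials d" "f - g \<in> mock_lie_ideal"
      "Poly_Mapping.keys g' \<subseteq> leftnormed_monomials d" "f' - g' \<in> mock_lie_ideal"
    using assms by (auto simp: leftnormed_classes_def)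
  have "(f + f') - (g + g') \<in> mock_lie_ideal"
    unfolding add_diff_add by (intro mock_lie_ideal_intros g)
  then show ?thesis
    using g Poly_Mapping.keys_add[of g g'] by (intro leftnormed_classesI[of _ "g + g'"]) auto
qed

lemma leftnormed_classes_nscale:
  assumes "f \<in> leftnormed_classes d"
  shows "nscale c f \<in> leftnormed_classes d"
proof -
  obtain g where g: "Poly_Mapping.keys g \<subseteq> leftnormed_monomials d" "f - g \<in> mock_lie_ideal"
    using assms by (auto simp: leftnormed_classes_def)
  have "nscale c f - nscale c g = nscale c (f - g)"
    by (simp add: magmatic.scale_right_diff_distrib)
  then show ?thesis
    using g keys_nscale[of c g]
    by (intro leftnormed_classesI[of _ "nscale c g"]) (auto intro: mock_lie_ideal_intros)
qed

lemma leftnormed_classes_cong: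
  assumes "f \<in> leftnormed_classes d" "f' - f \<in> mock_lie_ideal"
  shows "f' \<in> leftnormed_classes d"
proof -
  obtain g where g: "Poly_Mapping.keys g \<subseteq> leftnormed_monomials d" "f - g \<in> mock_lie_ideal"
    using assms by (auto simp: leftnormed_classes_def)
  have "f' - g \<in> mock_lie_ideal"
    using mock_lie_ideal_intros(2)[OF assms(2) g(2)] by simp
  then show ?thesis using g(1) by (rule leftnormed_classesI)
qed

lemma leftnormed_classes_mono:
  assumes "f \<in> leftnormed_classes d" "d \<le> e"
  shows "f \<in> leftnormed_classes e"
proof -
  have "leftnormed_monomials d \<subseteq> (leftnormed_monomials e :: nat magma set)"
    using assms(2) by (auto simp: leftnormed_monomials_def)
  then show ?thesis using assms(1) by (auto simp: leftnormed_classes_def)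
qed

lemma leftnormed_classes_zero: "0 \<in> leftnormed_classes d"
  by (rule leftnormed_classesI[of _ 0]) (simp_all add: mock_lie_ideal_intros)

lemma leftnormed_classes_sum:
  "(\<And>i. i \<in> A \<Longrightarrow> f i \<in> leftnormed_classes d) \<Longrightarrow> (\<Sum>i\<in>A. f i) \<in> leftnormed_classes d"
  by (induction A rule: infinite_finite_induct) (auto intro: leftnormed_classes_add leftnormed_classes_zero)

lemma single_MOp:
  "(Poly_Mapping.single (MOp s t) 1 :: ('v, 'k::field) nonassoc) = Poly_Mapping.single s 1 \<odot> Poly_Mapping.single t 1"
  by (simp add: nprod_def)

text \<open>Induction on the right factor: by \<open>mock_lie_flatten\<close>, multiplication by a product \<open>s t\<close>
  reduces to successive multiplication by \<open>s\<close> and \<open>t\<close> in both orders.\<close>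

lemma leftnormed_classes_nprod:
  fixes f :: "(nat, 'k::field) nonassoc"
  shows "f \<in> leftnormed_classes d \<Longrightarrow> f \<odot> Poly_Mapping.single m 1 \<in> leftnormed_classes (d + monomial_length m)"
proof (induction m arbitrary: f d)
  case (MVar v)
  obtain g where g: "Poly_Mapping.keys g \<subseteq> leftnormed_monomials d" "f - g \<in> mock_lie_ideal"
    using MVar by (auto simp: leftnormed_classes_def)
  let ?v = "Poly_Mapping.single (MVar v) 1 :: (nat, 'k) nonassoc"
  have "Poly_Mapping.keys (g \<odot> ?v) \<subseteq> (\<lambda>m. MOp m (MVar v)) ` Poly_Mapping.keys g"
  proof -
    have "g \<odot> ?v = (\<Sum>s\<in>Poly_Mapping.keys g. Poly_Mapping.single (MOp s (MVar v)) (Poly_Mapping.lookup g s))"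
      by (simp add: nprod_def)
    then show ?thesis
      using Poly_Mapping.keys_sum[of "\<lambda>s. Poly_Mapping.single (MOp s (MVar v)) (Poly_Mapping.lookup g s)" "Poly_Mapping.keys g"]
      by (force split: if_splits)
  qed
  also have "\<dots> \<subseteq> leftnormed_monomials (d + 1)"
  proof -
    have "MOp m (MVar v) \<in> leftnormed_monomials (d + 1)" if "m \<in> leftnormed_monomials d" for m
      using that by (auto simp: leftnormed_monomials_def leftnormed_monomial_snoc[symmetric] intro!: imageI)
    then show ?thesis using g(1) by blast
  qed
  finally show ?case
    using mock_lie_ideal_intros(6)[OF g(2), of ?v]
    by (intro leftnormed_classesI[of _ "g \<odot> ?v"]) (simp_all add: nprod_diff_left)
next
  case (MOp s t)
  let ?s = "Poly_Mapping.single s 1 :: (nat, 'k) nonassoc" and ?t = "Poly_Mapping.single t 1 :: (nat, 'k) nonassoc"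
  let ?d = "d + monomial_length (MOp s t)"
  have "f \<odot> ?s \<odot> ?t \<in> leftnormed_classes ?d" "f \<odot> ?t \<odot> ?s \<in> leftnormed_classes ?d"
    using MOp.IH(2)[OF MOp.IH(1)[OF MOp.prems]] MOp.IH(1)[OF MOp.IH(2)[OF MOp.prems]]
    by (simp_all add: ac_simps)
  then have "nscale (-1) (f \<odot> ?s \<odot> ?t + f \<odot> ?t \<odot> ?s) \<in> leftnormed_classes ?d"
    by (intro leftnormed_classes_nscale leftnormed_classes_add)
  then show ?case
  proof (rule leftnormed_classes_cong)
    show "f \<odot> Poly_Mapping.single (MOp s t) 1 - nscale (-1) (f \<odot> ?s \<odot> ?t + f \<odot> ?t \<odot> ?s) \<in> mock_lie_ideal"
      using mock_lie_flatten[of f ?s ?t]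
      by (simp add: single_MOp uminus_eq_nscale[symmetric] algebra_simps)
  qed
qed

lemma monomial_leftnormed_class:
  "(Poly_Mapping.single m 1 :: (nat, 'k::field) nonassoc) \<in> leftnormed_classes (monomial_length m)"
proof (induction m)
  case (MVar v)
  have "MVar v \<in> leftnormed_monomials 1"
    unfolding leftnormed_monomials_def
    by (rule image_eqI[of _ _ "[v]"]) (simp_all add: leftnormed_monomial_singleton)
  then show ?case
    by (intro leftnormed_classesI[of _ "Poly_Mapping.single (MVar v) 1"]) (simp_all add: mock_lie_ideal_intros)
next
  case (MOp s t)
  then show ?case by (simp add: single_MOp leftnormed_classes_nprod)
qed

lemma leftnormed_class_total_degree:
  fixes f :: "(nat, 'k::field) nonassoc"
  shows "f \<in> leftnormed_classes (total_degree f)"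
proof -
  have "f = (\<Sum>m\<in>Poly_Mapping.keys f. nscale (Poly_Mapping.lookup f m) (Poly_Mapping.single m 1))"
    by (rule poly_mapping_eqI)
       (simp add: lookup_sum lookup_single when_def in_keys_iff if_distrib[of "(*) _"]  cong: if_cong)
  also have "\<dots> \<in> leftnormed_classes (total_degree f)"
  proof (intro leftnormed_classes_sum leftnormed_classes_nscale)
    fix m assume "m \<in> Poly_Mapping.keys f"
    then have "monomial_length m \<le> total_degree f" by (auto simp: total_degree_def)
    then show "Poly_Mapping.single m 1 \<in> leftnormed_classes (total_degree f)"
      using monomial_leftnormed_class leftnormed_classes_mono by blast
  qed
  finally show ?thesis .
qed

lemma leftnormed_nprod_nvar:
  "q \<noteq> [] \<Longrightarrow> leftnormed nprod (map nvar q) = Poly_Mapping.single (leftnormed_monomial q) 1"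
  by (induction q rule: rev_nonempty_induct)
     (simp_all add: leftnormed_snoc leftnormed_monomial_singleton leftnormed_monomial_snoc single_MOp nvar_def)

section \<open>Multilinear identities of degree at most four\<close>

lemma mock_lie_ideal_halve:
  assumes "f + f \<in> mock_lie_ideal"
  shows "(f :: (nat, 'k::field_char_0) nonassoc) \<in> mock_lie_ideal"
proof -
  have "f = nscale (1/2) (f + f)"
    by (rule poly_mapping_eqI) (simp add: lookup_add)
  then show ?thesis using assms mock_lie_ideal_intros(5) by metis
qed

lemma mock_lie_left_commute: "((a \<odot> b) \<odot> c) \<odot> d - ((b \<odot> a) \<odot> c) \<odot> d \<in> mock_lie_ideal"
  using mock_lie_ideal_intros(6)[OF mock_lie_ideal_intros(6)[OF mock_lie_commute[of a b]], of c d]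
  by (simp add: nprod_diff_left)

text \<open>With \<open>S\<close> for the left-hand side, add up \<open>mock_lie_left_pairs\<close> over the cyclic permutations of
  \<open>a\<close>, \<open>b\<close>, \<open>c\<close>. On one side the Jacobi identity times \<open>t\<close> leaves \<open>S\<close>; on the other side the Jacobi
  identities for \<open>t\<close> and two of the three elements collect the terms into \<open>- S\<close>. Hence $2S$ lies in the ideal,
  and dividing by two uses the characteristic.\<close>

lemma mock_lie_cyclic_third:
  fixes a b c t :: "(nat, 'k::field_char_0) nonassoc"
  shows "((a \<odot> b) \<odot> t) \<odot> c + ((b \<odot> c) \<odot> t) \<odot> a + ((c \<odot> a) \<odot> t) \<odot> b \<in> mock_lie_ideal"
    (is "?f \<in> _")
proof (rule mock_lie_ideal_halve)
  let ?J = "\<lambda>a b c. (a \<odot> b) \<odot> c + (b \<odot> c) \<odot> a + (c \<odot> a) \<odot> b"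
  let ?P = "\<lambda>a b c d. ((a \<odot> b) \<odot> c) \<odot> d + ((a \<odot> b) \<odot> d) \<odot> c - ((c \<odot> d) \<odot> a) \<odot> b - ((c \<odot> d) \<odot> b) \<odot> a"
  have "?f + ?f = ?P a b t c + ?P b c t a + ?P c a t b - ?J a b c \<odot> t
     + ?J t c a \<odot> b + ?J t a b \<odot> c + ?J t b c \<odot> a
     + (t \<odot> a \<odot> c \<odot> b - a \<odot> t \<odot> c \<odot> b) + (t \<odot> b \<odot> a \<odot> c - b \<odot> t \<odot> a \<odot> c)
     + (t \<odot> c \<odot> b \<odot> a - c \<odot> t \<odot> b \<odot> a)"
    by (simp add: nprod_add_left algebra_simps)
  also have "\<dots> \<in> mock_lie_ideal"
    by (simp only: mock_lie_ideal_intros mock_lie_left_pairs mock_lie_left_jacobi mock_lie_left_commute)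
  finally show "?f + ?f \<in> mock_lie_ideal" .
qed

text \<open>Modulo the ideal the seven products whose coefficients stand on the right-hand sides of the
  assumptions are integer combinations of the five products on the left-hand sides. The assumptions say
  that the coefficient of each of these five becomes zero when the seven are eliminated.\<close>

lemma mock_lie_quartic_combination:
  fixes y :: "nat \<Rightarrow> (nat, 'k::field_char_0) nonassoc" and B :: "nat \<Rightarrow> nat \<Rightarrow> nat \<Rightarrow> nat \<Rightarrow> 'k"
  defines "D \<equiv> \<lambda>i j k l. ((y i \<odot> y j) \<odot> y k) \<odot> y l"
  assumes L: "B 0 1 2 3 = B 0 3 2 1 + B 1 2 0 3 - B 2 3 0 1"
    "B 0 1 3 2 = B 0 2 3 1 + B 1 3 0 2 - B 2 3 0 1"
    "B 0 2 1 3 = B 0 3 1 2 + B 1 2 0 3 - B 1 3 0 2"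
    "B 1 2 3 0 = B 0 2 3 1 - B 0 3 2 1 + B 1 3 2 0"
    "B 2 3 1 0 = B 0 3 1 2 - B 0 3 2 1 - B 1 3 0 2 + B 1 3 2 0 + B 2 3 0 1"
  shows "nscale (B 0 1 2 3) (D 0 1 2 3) + nscale (B 0 1 3 2) (D 0 1 3 2)
    + nscale (B 0 2 1 3) (D 0 2 1 3) + nscale (B 0 2 3 1) (D 0 2 3 1)
    + nscale (B 0 3 1 2) (D 0 3 1 2) + nscale (B 0 3 2 1) (D 0 3 2 1)
    + nscale (B 1 2 0 3) (D 1 2 0 3) + nscale (B 1 2 3 0) (D 1 2 3 0)
    + nscale (B 1 3 0 2) (D 1 3 0 2) + nscale (B 1 3 2 0) (D 1 3 2 0)
    + nscale (B 2 3 0 1) (D 2 3 0 1) + nscale (B 2 3 1 0) (D 2 3 1 0) \<in> mock_lie_ideal"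
    (is "?sum \<in> _")
proof -
  have swap: "D i j k l - D j i k l \<in> mock_lie_ideal" for i j k l
    unfolding D_def by (rule mock_lie_left_commute)
  have third: "D i j t k + D j k t i + D i k t j \<in> mock_lie_ideal" for i j k t
    using mock_lie_ideal_intros(2)[OF mock_lie_cyclic_third[of "y i" "y j" "y t" "y k"] swap[of i k t j]]
    by (simp add: D_def)
  have last: "D i j k l + D j k i l + D i k j l \<in> mock_lie_ideal" for i j k l
    using mock_lie_ideal_intros(2)[OF mock_lie_ideal_intros(6)[OF mock_lie_left_jacobi[of "y i" "y j" "y k"], of "y l"]
        swap[of i k j l]]
    by (simp add: D_def nprod_add_left)
  have pairs: "D 2 3 0 1 + D 2 3 1 0 - D 0 1 2 3 - D 0 1 3 2 \<in> mock_lie_ideal"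
    unfolding D_def by (rule mock_lie_left_pairs)
  \<comment> \<open>Each of the seven products has its relation. Those for \<open>0 3 2 1\<close> and \<open>1 3 0 2\<close> contain one more of the
    seven, namely \<open>1 3 2 0\<close> and \<open>0 3 1 2\<close>, hence the differences of coefficients.\<close>
  have "?sum = nscale (B 0 2 3 1) (D 0 1 3 2 + D 1 2 3 0 + D 0 2 3 1)
    + nscale (B 0 3 1 2 - B 1 3 0 2) (D 0 2 1 3 + D 2 3 1 0 + D 0 3 1 2)
    + nscale (B 0 3 2 1) (D 0 1 2 3 + D 1 3 2 0 + D 0 3 2 1)
    + nscale (B 1 2 0 3) (D 0 1 2 3 + D 1 2 0 3 + D 0 2 1 3)
    + nscale (B 1 3 0 2) (D 0 1 3 2 + D 1 3 0 2 + D 0 3 1 2)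
    + nscale (B 1 3 2 0 - B 0 3 2 1) (D 1 2 3 0 + D 2 3 1 0 + D 1 3 2 0)
    + nscale (B 2 3 0 1) (D 2 3 0 1 + D 2 3 1 0 - D 0 1 2 3 - D 0 1 3 2)"
    unfolding L by (rule poly_mapping_eqI) (simp only: lookup_add lookup_minus lookup_nscale, algebra)
  also have "\<dots> \<in> mock_lie_ideal"
    by (simp only: mock_lie_ideal_intros third last pairs)
  finally show ?thesis .
qed

lemma sum_permutations_2: "sum f (permutations_of_set {..<2::nat}) = f [0,1] + f [1,0]"
proof -
  have "permutations_of_set {..<2::nat} = set [[0,1],[1,0]]" by code_simp
  then show ?thesis by (simp add: sum.distinct_set_conv_list)
qed

lemma sum_permutations_3:
  "sum f (permutations_of_set {..<3::nat}) =
   f [0,1,2] + f [0,2,1] + f [1,0,2] + f [1,2,0] + f [2,0,1] + f [2,1,0]"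
proof -
  have "permutations_of_set {..<3::nat} = set [[0,1,2],[0,2,1],[1,0,2],[1,2,0],[2,0,1],[2,1,0]]"
    by code_simp
  then show ?thesis by (simp only:) (subst sum.distinct_set_conv_list, auto simp: ac_simps)
qed

lemma sum_permutations_4:
  "sum f (permutations_of_set {..<4::nat}) = sum_list (map f
    [[0,1,2,3],[0,1,3,2],[0,2,1,3],[0,2,3,1],[0,3,1,2],[0,3,2,1],
     [1,0,2,3],[1,0,3,2],[1,2,0,3],[1,2,3,0],[1,3,0,2],[1,3,2,0],
     [2,0,1,3],[2,0,3,1],[2,1,0,3],[2,1,3,0],[2,3,0,1],[2,3,1,0],
     [3,0,1,2],[3,0,2,1],[3,1,0,2],[3,1,2,0],[3,2,0,1],[3,2,1,0]])"
  (is "_ = sum_list (map f ?perms)")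
proof -
  have "permutations_of_set {..<4::nat} = set ?perms" by code_simp
  then show ?thesis by (simp only:) (subst sum.distinct_set_conv_list, auto)
qed

lemma multilinear_identity_weight:
  fixes \<beta> :: "nat list \<Rightarrow> 'k::field" and z :: "nat \<Rightarrow> ('x, 'k) As1"
  assumes "\<And>z :: nat \<Rightarrow> ('x, 'k) As1.
    (\<Sum>q\<in>permutations_of_set S. As1_scale (\<beta> q) (leftnormed anticommutator (map z q))) = 0"
  shows "(\<Sum>q\<in>permutations_of_set S. \<beta> q * As1_weight x (leftnormed anticommutator (map z q))) = 0"
proof -
  have "As1_weight x (\<Sum>q\<in>permutations_of_set S. As1_scale (\<beta> q) (leftnormed anticommutator (map z q))) = 0"
    by (simp add: assms)
  then show ?thesis by (simp add: As1_weight_sum As1_weight_scale)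
qed

text \<open>In each degree enough substitutions are made to obtain linear equations between the
  coefficients which force the combination into the ideal. In degree one, the coefficient is zero; in degree two, the equation says that the combination is a multiple of
  $u_0u_1 - u_1u_0$; in degree three, that it is a multiple of the Jacobi sum up to commutativity; degree four is
  \<open>mock_lie_quartic_combination\<close>.\<close>

lemma multilinear_identity:
  fixes \<beta> :: "nat list \<Rightarrow> 'k::field_char_0" and x y :: 'x
  assumes xy: "x \<noteq> y" and d: "1 \<le> d" "d \<le> 4"
    and id: "\<And>z :: nat \<Rightarrow> ('x, 'k) As1. (\<Sum>q\<in>permutations_of_set {..<d}.
          As1_scale (\<beta> q) (leftnormed anticommutator (map z q))) = 0"
  shows "(\<Sum>q\<in>permutations_of_set {..<d}. nscale (\<beta> q) (leftnormed nprod (map u q))) \<in> mock_lie_ideal"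
proof -
  define X Y :: "('x, 'k) As1" where "X = As1_gen x" and "Y = As1_gen y"
  note weight = multilinear_identity_weight[OF id, of x]
  note weights = weight_degree_1 weight_degree_2 weight_degree_3 weight_degree_4
  note weights = weights[OF xy X_def Y_def]
  have comm: "anticommutator (X * Y) X = anticommutator X (X * Y)"
    "anticommutator (X * Y) Y = anticommutator Y (X * Y)"
    "anticommutator Y X = anticommutator X Y"
    by (simp_all add: anticommutator_def add.commute)
  consider "d = 1" | "d = 2" | "d = 3" | "d = 4" using d by linarith
  then show ?thesis
  proof cases
    case 1
    have "\<beta> [0] = 0"
      using weight[of "\<lambda>_. X * (X * (Y * (X * Y)))"] by (simp add: 1 lessThan_Suc weights)
    then show ?thesis by (simp add: 1 lessThan_Suc mock_lie_ideal_intros)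
  next
    case 2
    have "\<beta> [1,0] = - \<beta> [0,1]"
      using weight[of "(!) [X, X * (X * (Y * Y))]"]
      by (simp add: 2 sum_permutations_2 leftnormed_def weights)
    then have "(\<Sum>q\<in>permutations_of_set {..<d}. nscale (\<beta> q) (leftnormed nprod (map u q)))
        = nscale (\<beta> [0,1]) (u 0 \<odot> u 1 - u 1 \<odot> u 0)"
      unfolding 2 sum_permutations_2
      by (intro poly_mapping_eqI) (simp add: leftnormed_def lookup_add lookup_minus algebra_simps)
    then show ?thesis by (simp add: mock_lie_ideal_intros mock_lie_commute)
  next
    case 3
    define \<gamma> where "\<gamma> i j k = \<beta> [i,j,k] + \<beta> [j,i,k]" for i j k
    have "2 * \<gamma> 0 1 2 - \<gamma> 0 2 1 - \<gamma> 1 2 0 = 0"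
      using weight[of "(!) [X, X, X * (Y * Y)]"] unfolding 3 sum_permutations_3
      by (simp add: leftnormed_def weights \<gamma>_def algebra_simps)
    moreover have "2 * \<gamma> 0 2 1 - \<gamma> 0 1 2 - \<gamma> 1 2 0 = 0"
      using weight[of "(!) [X, X * (Y * Y), X]"] unfolding 3 sum_permutations_3
      by (simp add: leftnormed_def weights \<gamma>_def algebra_simps)
    ultimately have "\<gamma> 0 2 1 = \<gamma> 0 1 2" "\<gamma> 1 2 0 = \<gamma> 0 1 2" by algebra+
    then have *: "\<beta> [0,2,1] = \<gamma> 0 1 2 - \<beta> [2,0,1]" "\<beta> [1,2,0] = \<gamma> 0 1 2 - \<beta> [2,1,0]"
      "\<beta> [0,1,2] = \<gamma> 0 1 2 - \<beta> [1,0,2]" by (simp_all add: \<gamma>_def algebra_simps)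
    have "(\<Sum>q\<in>permutations_of_set {..<d}. nscale (\<beta> q) (leftnormed nprod (map u q)))
        = nscale (\<gamma> 0 1 2) (u 0 \<odot> u 1 \<odot> u 2 + u 1 \<odot> u 2 \<odot> u 0 + u 2 \<odot> u 0 \<odot> u 1)
        + nscale (\<gamma> 0 1 2) ((u 0 \<odot> u 2 - u 2 \<odot> u 0) \<odot> u 1)
        + nscale (\<beta> [1,0,2]) ((u 1 \<odot> u 0 - u 0 \<odot> u 1) \<odot> u 2)
        + nscale (\<beta> [2,0,1]) ((u 2 \<odot> u 0 - u 0 \<odot> u 2) \<odot> u 1)
        + nscale (\<beta> [2,1,0]) ((u 2 \<odot> u 1 - u 1 \<odot> u 2) \<odot> u 0)"
      unfolding 3 sum_permutations_3 *
      by (intro poly_mapping_eqI) (simp add: leftnormed_def nprod_diff_left lookup_add lookup_minus algebra_simps)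
    also have "\<dots> \<in> mock_lie_ideal"
      by (simp only: mock_lie_ideal_intros mock_lie_commute mock_lie_left_jacobi)
    finally show ?thesis .
  next
    case 4
    define B where "B i j k l = \<beta> [i,j,k,l] + \<beta> [j,i,k,l]" for i j k l
    have B_sym: "B 1 0 = B 0 1" "B 2 0 = B 0 2" "B 3 0 = B 0 3" "B 2 1 = B 1 2" "B 3 1 = B 1 3" "B 3 2 = B 2 3"
      by (auto simp: B_def add.commute fun_eq_iff)
    \<comment> \<open>The equation that results from substituting \<open>X\<close> for \<open>i\<close> and \<open>j\<close>, \<open>Y\<close> for \<open>k\<close> and \<open>X * Y\<close> for \<open>l\<close>; the
      coefficients are the weights in \<open>weight_degree_4\<close>.\<close>
    define R where "R i j k l = 2 * B i j k l - 4 * B i j l k - B i k j l - B j k i l + 2 * B i k l j + 2 * B j k l i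
       + 2 * B i l j k + 2 * B j l i k - B i l k j - B j l k i - B k l i j - B k l j i" for i j k l
    \<comment> \<open>These five of the twelve possible substitutions have rank five.\<close>
    have "R 0 1 2 3 = 0" "R 0 2 3 1 = 0" "R 0 3 2 1 = 0" "R 1 3 0 2 = 0" "R 2 3 1 0 = 0"
      using weight[of "(!) [X, X, Y, X * Y]"] weight[of "(!) [X, X * Y, X, Y]"]
        weight[of "(!) [X, X * Y, Y, X]"] weight[of "(!) [Y, X, X * Y, X]"] weight[of "(!) [X * Y, Y, X, X]"]
      unfolding 4 sum_permutations_4
      by (simp_all add: leftnormed_def weights comm R_def B_def algebra_simps)
    note R = this[unfolded R_def B_sym]
    have L: "B 0 1 2 3 = B 0 3 2 1 + B 1 2 0 3 - B 2 3 0 1"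
      "B 0 1 3 2 = B 0 2 3 1 + B 1 3 0 2 - B 2 3 0 1"
      "B 0 2 1 3 = B 0 3 1 2 + B 1 2 0 3 - B 1 3 0 2"
      "B 1 2 3 0 = B 0 2 3 1 - B 0 3 2 1 + B 1 3 2 0"
      "B 2 3 1 0 = B 0 3 1 2 - B 0 3 2 1 - B 1 3 0 2 + B 1 3 2 0 + B 2 3 0 1"
      using R by algebra+
    let ?D = "\<lambda>i j k l. ((u i \<odot> u j) \<odot> u k) \<odot> u l"
    \<comment> \<open>The error made by replacing the product indexed by \<open>j i k l\<close> by the one indexed by \<open>i j k l\<close>.\<close>
    let ?c = "\<lambda>i j k l. nscale (\<beta> [j, i, k, l]) (?D j i k l - ?D i j k l)"
    have "(\<Sum>q\<in>permutations_of_set {..<d}. nscale (\<beta> q) (leftnormed nprod (map u q)))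
      = (nscale (B 0 1 2 3) (?D 0 1 2 3) + nscale (B 0 1 3 2) (?D 0 1 3 2)
        + nscale (B 0 2 1 3) (?D 0 2 1 3) + nscale (B 0 2 3 1) (?D 0 2 3 1)
        + nscale (B 0 3 1 2) (?D 0 3 1 2) + nscale (B 0 3 2 1) (?D 0 3 2 1)
        + nscale (B 1 2 0 3) (?D 1 2 0 3) + nscale (B 1 2 3 0) (?D 1 2 3 0)
        + nscale (B 1 3 0 2) (?D 1 3 0 2) + nscale (B 1 3 2 0) (?D 1 3 2 0)
        + nscale (B 2 3 0 1) (?D 2 3 0 1) + nscale (B 2 3 1 0) (?D 2 3 1 0))
      + (?c 0 1 2 3 + ?c 0 1 3 2 + ?c 0 2 1 3 + ?c 0 2 3 1 + ?c 0 3 1 2 + ?c 0 3 2 1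
        + ?c 1 2 0 3 + ?c 1 2 3 0 + ?c 1 3 0 2 + ?c 1 3 2 0 + ?c 2 3 0 1 + ?c 2 3 1 0)"
      unfolding 4 sum_permutations_4 B_def
      by (intro poly_mapping_eqI) (simp add: leftnormed_def lookup_add lookup_minus algebra_simps)
    also have "\<dots> \<in> mock_lie_ideal"
      by (intro mock_lie_ideal_intros(2) mock_lie_quartic_combination L mock_lie_ideal_intros(5) mock_lie_left_commute)
    finally show ?thesis .
  qed
qed

section \<open>From multilinear identities to all identities\<close>

text \<open>For each fixed order \<open>q\<close> of the labels, a list of variables arises from exactly one assignment of
  variables to labels. This is what makes every term of degree \<open>d\<close> appear $d!$ times in the sum of all
  polarizations.\<close>

lemma bij_betw_map_permutation:
  fixes q :: "nat list"
  assumes q: "q \<in> permutations_of_set S" and S: "finite S" and V: "finite V"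
  shows "bij_betw (\<lambda>p. map p q) (S \<rightarrow>\<^sub>E V) {l. set l \<subseteq> V \<and> length l = card S}"
proof -
  have sq: "set q = S" "distinct q" "length q = card S"
    using q by (auto simp: permutations_of_set_def distinct_card)
  have inj: "inj_on (\<lambda>p. map p q) (S \<rightarrow>\<^sub>E V)"
  proof (rule inj_onI)
    fix p p' assume "p \<in> S \<rightarrow>\<^sub>E V" "p' \<in> S \<rightarrow>\<^sub>E V" "map p q = map p' q"
    then show "p = p'" using sq by (intro PiE_ext) auto
  qed
  have "(\<lambda>p. map p q) ` (S \<rightarrow>\<^sub>E V) = {l. set l \<subseteq> V \<and> length l = card S}"
  proof (rule card_subset_eq)
    show "finite {l. set l \<subseteq> V \<and> length l = card S}" by (rule finite_lists_length_eq[OF V])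
    show "(\<lambda>p. map p q) ` (S \<rightarrow>\<^sub>E V) \<subseteq> {l. set l \<subseteq> V \<and> length l = card S}"
      using sq by auto
    show "card ((\<lambda>p. map p q) ` (S \<rightarrow>\<^sub>E V)) = card {l. set l \<subseteq> V \<and> length l = card S}"
      using card_image[OF inj] S V by (simp add: card_PiE card_lists_length_eq)
  qed
  with inj show ?thesis by (simp add: bij_betw_def)
qed

definition leftnormed_part :: "nat \<Rightarrow> ('v, 'k::field) nonassoc \<Rightarrow> ('v, 'k) nonassoc" where
  "leftnormed_part d g = (\<Sum>m\<in>{m\<in>Poly_Mapping.keys g. length (leaves m) = d}.
     Poly_Mapping.single m (Poly_Mapping.lookup g m))"

lemma lookup_leftnormed_part:
  "Poly_Mapping.lookup (leftnormed_part d g) m = (if length (leaves m) = d then Poly_Mapping.lookup g m else 0)"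
proof -
  let ?K = "{m\<in>Poly_Mapping.keys g. length (leaves m) = d}"
  have "Poly_Mapping.lookup (leftnormed_part d g) m = (\<Sum>n\<in>?K. if n = m then Poly_Mapping.lookup g n else 0)"
    by (simp add: leftnormed_part_def lookup_sum lookup_single when_def)
  then show ?thesis by (simp add: in_keys_iff)
qed

text \<open>Substituting the variables back into the polarizations and summing over all assignments \<open>p\<close> recovers
  $d!$ times the homogeneous part of degree \<open>d\<close>.\<close>

lemma leftnormed_part_in_ideal:
  fixes g :: "(nat, 'k::field_char_0) nonassoc" and x y :: 'x
  assumes xy: "x \<noteq> y" and d: "1 \<le> d" "d \<le> 4"
    and g: "Poly_Mapping.keys g \<subseteq> leftnormed_monomials d"
    and id: "is_identity (As1_scale :: 'k \<Rightarrow> ('x, 'k) As1 \<Rightarrow> _) anticommutator g"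
  shows "leftnormed_part d g \<in> mock_lie_ideal"
proof -
  let ?\<alpha> = "\<lambda>l. Poly_Mapping.lookup g (leftnormed_monomial l)"
  let ?term = "\<lambda>l. Poly_Mapping.single (leftnormed_monomial l) (?\<alpha> l) :: (nat, 'k) nonassoc"
  \<comment> \<open>Restricting to the variables of \<open>g\<close> makes the sum over all assignments finite.\<close>
  define V where "V = (\<Union>m\<in>Poly_Mapping.keys g. set (leaves m))"
  define Ls where "Ls = {l. set l \<subseteq> V \<and> length l = d}"
  have V: "finite V" by (simp add: V_def)
  have nonempty: "q \<noteq> []" if "q \<in> permutations_of_set {..<d}" for q
    using length_finite_permutations_of_set[OF that] d by auto
  have polarized: "(\<Sum>q\<in>permutations_of_set {..<d}. ?term (map p q)) \<in> mock_lie_ideal" for p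
  proof -
    have "(\<Sum>q\<in>permutations_of_set {..<d}.
        As1_scale (?\<alpha> (map p q)) (leftnormed anticommutator (map z q))) = 0" for z :: "nat \<Rightarrow> ('x, 'k) As1"
      using As1_plus.polarization[OF g id, of "{..<d}" p z] by (simp only: card_lessThan finite_lessThan)
    then have "(\<Sum>q\<in>permutations_of_set {..<d}. nscale (?\<alpha> (map p q)) (leftnormed nprod (map (\<lambda>i. nvar (p i)) q)))
        \<in> mock_lie_ideal"
      using multilinear_identity[OF xy d, of "\<lambda>q. ?\<alpha> (map p q)" "\<lambda>i. nvar (p i)"] by blast
    moreover have "nscale (?\<alpha> (map p q)) (leftnormed nprod (map (\<lambda>i. nvar (p i)) q)) = ?term (map p q)"
      if "q \<in> permutations_of_set {..<d}" for q
      using leftnormed_nprod_nvar[of "map p q", where ?'b = 'k] nonempty[OF that] by (simp add: comp_def nscale_single)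
    ultimately show ?thesis by simp
  qed
  have "nscale (of_nat (fact d)) (\<Sum>l\<in>Ls. ?term l) = (\<Sum>q\<in>permutations_of_set {..<d}. \<Sum>l\<in>Ls. ?term l)"
  proof -
    have "(\<Sum>i\<in>A. f) = nscale (of_nat (card A)) f" for A :: "nat list set" and f :: "(nat, 'k) nonassoc"
      by (induction A rule: infinite_finite_induct) (simp_all add: nscale_add_left magmatic.scale_zero_left)
    then show ?thesis by simp
  qed
  also have "\<dots> = (\<Sum>q\<in>permutations_of_set {..<d}. \<Sum>p\<in>{..<d} \<rightarrow>\<^sub>E V. ?term (map p q))"
    using sum.reindex_bij_betw[OF bij_betw_map_permutation[OF _ _ V, of _ "{..<d}"], of _ ?term]
    by (simp add: Ls_def)
  also have "\<dots> = (\<Sum>p\<in>{..<d} \<rightarrow>\<^sub>E V. \<Sum>q\<in>permutations_of_set {..<d}. ?term (map p q))"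
    by (rule sum.swap)
  also have "\<dots> \<in> mock_lie_ideal"
    by (intro mock_lie_ideal_sum polarized)
  finally have "nscale (inverse (of_nat (fact d))) (nscale (of_nat (fact d)) (\<Sum>l\<in>Ls. ?term l)) \<in> mock_lie_ideal"
    by (rule mock_lie_ideal_intros(5))
  then have "(\<Sum>l\<in>Ls. ?term l) \<in> mock_lie_ideal" by (simp add: nscale_nscale)
  also have "(\<Sum>l\<in>Ls. ?term l) = leftnormed_part d g"
  proof -
    have ne: "l \<noteq> []" if "l \<in> Ls" for l using that d by (auto simp: Ls_def)
    have "(\<Sum>l\<in>Ls. ?term l) = (\<Sum>m\<in>leftnormed_monomial ` Ls. Poly_Mapping.single m (Poly_Mapping.lookup g m))"
      by (subst sum.reindex) (auto intro!: inj_onI simp: ne)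
    also have "\<dots> = leftnormed_part d g"
      unfolding leftnormed_part_def
    proof (rule sum.mono_neutral_right)
      show "finite (leftnormed_monomial ` Ls)" using finite_lists_length_eq[OF V, of d] by (simp add: Ls_def)
      show "{m\<in>Poly_Mapping.keys g. length (leaves m) = d} \<subseteq> leftnormed_monomial ` Ls"
      proof
        fix m assume m: "m \<in> {m\<in>Poly_Mapping.keys g. length (leaves m) = d}"
        then obtain l where l: "l \<noteq> []" "m = leftnormed_monomial l"
          using g by (auto simp: leftnormed_monomials_def)
        have "set (leaves m) \<subseteq> V" using m by (auto simp: V_def)
        then show "m \<in> leftnormed_monomial ` Ls" using m l by (auto simp: leaves_leftnormed_monomial Ls_def)
      qed
      show "\<forall>m\<in>leftnormed_monomial ` Ls - {m\<in>Poly_Mapping.keys g. length (leaves m) = d}.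
          Poly_Mapping.single m (Poly_Mapping.lookup g m) = 0"
        using ne by (auto simp: leaves_leftnormed_monomial Ls_def in_keys_iff)
    qed
    finally show ?thesis .
  qed
  finally show ?thesis .
qed

text \<open>Since the ideal consists of identities, removing the part of highest degree leaves an identity of smaller
  degree.\<close>

lemma leftnormed_identity_in_ideal:
  fixes g :: "(nat, 'k::field_char_0) nonassoc" and x y :: 'x
  assumes xy: "x \<noteq> y" and "d \<le> 4" and "Poly_Mapping.keys g \<subseteq> leftnormed_monomials d"
    and "is_identity (As1_scale :: 'k \<Rightarrow> ('x, 'k) As1 \<Rightarrow> _) anticommutator g"
  shows "g \<in> mock_lie_ideal"
  using assms(2-)
proof (induction d arbitrary: g)
  case 0
  then have "g = 0" by (simp add: leftnormed_monomials_def)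
  then show ?case by (simp add: mock_lie_ideal_intros)
next
  case (Suc d)
  let ?h = "leftnormed_part (Suc d) g"
  have h: "?h \<in> mock_lie_ideal" using Suc.prems by (intro leftnormed_part_in_ideal[OF xy]) auto
  have "Poly_Mapping.keys (g - ?h) \<subseteq> leftnormed_monomials d"
  proof
    fix m assume "m \<in> Poly_Mapping.keys (g - ?h)"
    then have m: "m \<in> Poly_Mapping.keys g" "length (leaves m) \<noteq> Suc d"
      by (auto simp: in_keys_iff lookup_minus lookup_leftnormed_part split: if_splits)
    then obtain l where l: "l \<noteq> []" "length l \<le> Suc d" "m = leftnormed_monomial l"
      using Suc.prems(2) by (auto simp: leftnormed_monomials_def)
    with m have "length l \<noteq> Suc d" using leaves_leftnormed_monomial[OF l(1)] by simp
    with l show "m \<in> leftnormed_monomials d" by (auto simp: leftnormed_monomials_def)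
  qed
  moreover have "is_identity (As1_scale :: 'k \<Rightarrow> ('x, 'k) As1 \<Rightarrow> _) anticommutator (g - ?h)"
    using Suc.prems(3) mock_lie_ideal_identities[OF h, where ?'x = 'x]
    by (simp add: is_identity_def As1_plus.evaluate_diff)
  ultimately have "g - ?h \<in> mock_lie_ideal" using Suc.prems(1) by (intro Suc.IH) auto
  then show ?case using mock_lie_ideal_intros(2)[OF _ h] by fastforce
qed

theorem theorem3:
  shows "(\<forall>g \<in> {commutativity, jacobi_identity, quartic_identity}.
            is_identity (As1_scale :: 'k::field_char_0 \<Rightarrow> ('x, 'k) As1 \<Rightarrow> ('x, 'k) As1) anticommutator g) \<and>
         ((\<exists>x y :: 'x. x \<noteq> y) \<longrightarrow>
          (\<forall>f. total_degree f \<le> 4 \<longrightarrow>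
             is_identity (As1_scale :: 'k \<Rightarrow> ('x, 'k) As1 \<Rightarrow> ('x, 'k) As1) anticommutator f \<longrightarrow>
             follows_from f {commutativity, jacobi_identity, quartic_identity}))"
proof (intro conjI ballI impI allI)
  fix g :: "(nat, 'k) nonassoc"
  assume "g \<in> {commutativity, jacobi_identity, quartic_identity}"
  then show "is_identity (As1_scale :: 'k \<Rightarrow> ('x, 'k) As1 \<Rightarrow> ('x, 'k) As1) anticommutator g"
    by (rule defining_identities_hold)
next
  fix f :: "(nat, 'k) nonassoc"
  assume "\<exists>x y :: 'x. x \<noteq> y" and deg: "total_degree f \<le> 4"
    and f: "is_identity (As1_scale :: 'k \<Rightarrow> ('x, 'k) As1 \<Rightarrow> ('x, 'k) As1) anticommutator f"
  then obtain x y :: 'x where xy: "x \<noteq> y" by blast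
  obtain g where g: "Poly_Mapping.keys g \<subseteq> leftnormed_monomials (total_degree f)" "f - g \<in> mock_lie_ideal"
    using leftnormed_class_total_degree[of f] by (auto simp: leftnormed_classes_def)
  have "is_identity (As1_scale :: 'k \<Rightarrow> ('x, 'k) As1 \<Rightarrow> ('x, 'k) As1) anticommutator g"
    using f mock_lie_ideal_identities[OF g(2), where ?'x = 'x]
    by (simp add: is_identity_def As1_plus.evaluate_diff)
  then have "g \<in> mock_lie_ideal" using leftnormed_identity_in_ideal[OF xy deg g(1)] by blast
  then have "(f - g) + g \<in> mock_lie_ideal" by (intro mock_lie_ideal_intros(2) g(2))
  then show "follows_from f {commutativity, jacobi_identity, quartic_identity}"
    by (simp add: follows_from_def mock_lie_ideal_def)
qed

end
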